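(* Let $\sigma:\mathbb{R}^d\to\mathbb{R}^d\otimes\mathbb{R}^m$ and $b:\mathbb{R}^d\to\mathbb{R}^d$ be continuous and assume: (a) there is a $C^1$ function $r_1:[1,\infty)\to\mathbb{R}_+$ with $\lim_{s\to\infty}r_1(s)=\infty$, $\int_1^\infty\frac{ds}{s r_1(s)+1}=\infty$, $\lim_{s\to\infty}\frac{s r_1'(s)}{r_1(s)}=0$, and a constant $C>0$ such that for $|x|\ge1$, $\|\sigma(x)\|^2\le C(|x|^2r_1(|x|^2)+1)$ and $|b(x)|\le C(|x|r_1(|x|^2)+1)$; (b) there is a $C^1$ function $r_2:(0,1)\to\mathbb{R}_+$ with $\lim_{\xi\to0}r_2(\xi)=\infty$, $\lim_{\xi\to0}\frac{\xi r_2'(\xi)}{r_2(\xi)}=0$, $\int_0^a\frac{ds}{s r_2(s)}=\infty$ for all $a\in(0,1)$, such that for $0<|x-y|<1$, $\|\sigma(x)-\sigma(y)\|^2\le C|x-y|^2r_2(|x-y|^2)$ and $|b(x)-b(y)|\le C|x-y|r_2(|x-y|^2)$. For $x_0\in\mathbb{R}^d$ let $X(t,x_0)$ be the (unique, global) solution of $dX(t)=\sigma(X(t))dW_t+b(X(t))dt$, $X(0)=x_0$, driven by a fixed $m$-dimensional Brownian motion $W$. Then for every $t>0$ and every $\varepsilon>0$, $$\lim_{y_0\to x_0}P\Big(\sup_{0\le s\le t}|X(s,y_0)-X(s,x_0)|>\varepsilon\Big)=0.$$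
   Context: $|\cdot|$ is the Euclidean norm on $\mathbb{R}^d$ and $\|\sigma\|^2=\sum_{i,j}\sigma_{ij}^2$. *)

theory Defs
  imports "HOL-Probability.Probability"
begin

definition conv_in_prob :: "'a measure \<Rightarrow> (nat \<Rightarrow> 'a \<Rightarrow> 'b::metric_space) \<Rightarrow> ('a \<Rightarrow> 'b) \<Rightarrow> bool" where
  "conv_in_prob M Y Z \<longleftrightarrow>
     (\<forall>e>0. (\<lambda>n. measure M {\<omega> \<in> space M. dist (Y n \<omega>) (Z \<omega>) > e}) \<longlonglongrightarrow> 0)"

definition is_filtration :: "'a measure \<Rightarrow> (real \<Rightarrow> 'a measure) \<Rightarrow> bool" where
  "is_filtration M F \<longleftrightarrow> (\<forall>t. subalgebra M (F t)) \<and> (\<forall>s t. s \<le> t \<longrightarrow> sets (F s) \<subseteq> sets (F t))"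

text \<open>Standard m-dimensional (F_t)-Brownian motion: W(0)=0, continuous paths, adapted, and
  for 0 \<le> s < t the increment W(t)-W(s) is independent of F_s and is centred Gaussian with
  covariance (t-s) I (expressed via Cramer-Wold: every nonzero projection u.(W t - W s) is
  N(0,(t-s)|u|^2)).\<close>
definition brownian_motion ::
  "'a measure \<Rightarrow> (real \<Rightarrow> 'a measure) \<Rightarrow> (real \<Rightarrow> 'a \<Rightarrow> real^'m) \<Rightarrow> bool" where
  "brownian_motion M F W \<longleftrightarrow>
     prob_space M \<and> is_filtration M F \<and>
     (\<forall>\<omega>\<in>space M. W 0 \<omega> = 0) \<and>
     (\<forall>\<omega>\<in>space M. continuous_on {0..} (\<lambda>t. W t \<omega>)) \<and>
     (\<forall>t\<ge>0. W t \<in> borel_measurable (F t)) \<and>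
     (\<forall>s t. 0 \<le> s \<and> s < t \<longrightarrow>
        prob_space.indep_set M (sets (F s))
          {(\<lambda>\<omega>. W t \<omega> - W s \<omega>) -` A \<inter> space M | A. A \<in> sets borel} \<and>
        (\<forall>u::real^'m. u \<noteq> 0 \<longrightarrow>
           distributed M lborel (\<lambda>\<omega>. u \<bullet> (W t \<omega> - W s \<omega>))
             (normal_density 0 (sqrt (t - s) * norm u))))"

definition ito_riemann_sum ::
  "(real \<Rightarrow> 'a \<Rightarrow> real^'m^'d) \<Rightarrow> (real \<Rightarrow> 'a \<Rightarrow> real^'m) \<Rightarrow> real \<Rightarrow> nat \<Rightarrow> 'a \<Rightarrow> real^'d" where
  "ito_riemann_sum H W t n \<omega> =
     (\<Sum>k<n. H (real k * t / real n) \<omega> *v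
        (W (real (Suc k) * t / real n) \<omega> - W (real k * t / real n) \<omega>))"

text \<open>Ito integral \<integral>_0^t H dW of a continuous adapted integrand: I is (a version of) it iff the
  left-point Riemann sums converge in probability to I.\<close>
definition is_ito_integral ::
  "'a measure \<Rightarrow> (real \<Rightarrow> 'a \<Rightarrow> real^'m^'d) \<Rightarrow> (real \<Rightarrow> 'a \<Rightarrow> real^'m) \<Rightarrow> real \<Rightarrow> ('a \<Rightarrow> real^'d) \<Rightarrow> bool" where
  "is_ito_integral M H W t I \<longleftrightarrow> conv_in_prob M (ito_riemann_sum H W t) I"

definition sde_solution ::
  "'a measure \<Rightarrow> (real \<Rightarrow> 'a measure) \<Rightarrow> (real \<Rightarrow> 'a \<Rightarrow> real^'m) \<Rightarrow>
   (real^'d \<Rightarrow> real^'m^'d) \<Rightarrow> (real^'d \<Rightarrow> real^'d) \<Rightarrow> real^'d \<Rightarrow> (real \<Rightarrow> 'a \<Rightarrow> real^'d) \<Rightarrow> bool" where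
  "sde_solution M F W \<sigma> b x0 X \<longleftrightarrow>
     (\<forall>\<omega>\<in>space M. X 0 \<omega> = x0) \<and>
     (\<forall>\<omega>\<in>space M. continuous_on {0..} (\<lambda>t. X t \<omega>)) \<and>
     (\<forall>t\<ge>0. X t \<in> borel_measurable (F t)) \<and>
     (\<forall>t\<ge>0. is_ito_integral M (\<lambda>s \<omega>. \<sigma> (X s \<omega>)) W t
               (\<lambda>\<omega>. X t \<omega> - x0 - integral {0..t} (\<lambda>s. b (X s \<omega>))))"

end

theory Submission
  imports Defs
begin

text \<open>
  Write \<open>\<mu>(s) = s r\<^sub>2(s)\<close>, which is increasing near \<open>0\<close>, and let \<open>g(\<xi>)\<close> be the integral of
  \<open>1 / (\<mu>(s) + \<delta>)\<close> over \<open>0 \<le> s \<le> \<xi>\<close>. Then \<open>g\<close> is concave, so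
  \<open>g(|z + h|\<^sup>2) \<le> g(|z|\<^sup>2) + g'(|z|\<^sup>2) (2 z \<bullet> h + |h|\<^sup>2)\<close>, and no Ito formula is needed: the drift of
  \<open>g(|\<eta>|\<^sup>2)\<close>, where \<open>\<eta>\<close> is the difference of two solutions, is at most a constant \<open>L\<close> that depends
  neither on \<open>\<delta>\<close> nor on the initial points. Hence
  \<open>P(sup |\<eta>| > \<epsilon>) \<le> (g(|y\<^sub>0 - x\<^sub>0|\<^sup>2) + L t) / g(\<epsilon>\<^sup>2 / 4)\<close>. Let \<open>y\<^sub>0\<close> tend to \<open>x\<^sub>0\<close>, and then \<open>\<delta>\<close> to \<open>0\<close>:
  \<open>g(\<epsilon>\<^sup>2 / 4)\<close> tends to infinity by the integral condition on \<open>r\<^sub>2\<close>.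

  The drift estimate is carried out for Euler sums on a fine grid with \<open>N n\<close> steps, whose coefficients are
  taken along the true solutions. At the \<open>N + 1\<close> points of the coarse grid these sums converge to \<open>\<eta>\<close> in
  probability as \<open>n\<close> tends to infinity, directly from the definition of the Ito integral. Stopping the sums
  once \<open>|\<eta>| > \<epsilon>\<close> at a coarse point, or once a path is large, oscillates too much or is badly
  approximated, makes all quantities bounded; the last three events become negligible in the limit.
\<close>

section \<open>Sums of independent noise with adapted coefficients\<close>

lemma norm_matrix_vector_mult_le:
  fixes A :: "real^'m^'d" and x :: "real^'m"
  shows "norm (A *v x) \<le> norm A * norm x"
proof -
  have "norm (A *v x) = L2_set (\<lambda>i. \<bar>A $ i \<bullet> x\<bar>) UNIV"
    by (simp add: norm_vec_def matrix_vector_mult_def inner_vec_def)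
  also have "\<dots> \<le> L2_set (\<lambda>i. norm (A $ i) * norm x) UNIV"
    by (intro L2_set_mono Cauchy_Schwarz_ineq2) auto
  also have "\<dots> = norm A * norm x"
    by (simp add: L2_set_left_distrib norm_vec_def[of A])
  finally show ?thesis .
qed

lemma continuous_on_matrix_vector_mult_pair:
  "continuous_on UNIV (\<lambda>p. (fst p :: real^'m^'d) *v snd p)"
  unfolding matrix_vector_mult_def by (intro continuous_intros)

lemma borel_measurable_matrix_vector_mult:
  fixes A :: "'a \<Rightarrow> real^'m^'d" and x :: "'a \<Rightarrow> real^'m"
  assumes "A \<in> borel_measurable N" "x \<in> borel_measurable N"
  shows "(\<lambda>\<omega>. A \<omega> *v x \<omega>) \<in> borel_measurable N"
  using borel_measurable_continuous_Pair[OF assms continuous_on_matrix_vector_mult_pair] .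

lemma borel_measurable_vec_nth_comp:
  fixes f :: "'a \<Rightarrow> 'b::{second_countable_topology,t2_space}^'n"
  assumes "f \<in> borel_measurable N"
  shows "(\<lambda>\<omega>. f \<omega> $ i) \<in> borel_measurable N"
  using measurable_compose[OF assms borel_measurable_continuous_onI[of "\<lambda>x. x $ i"]]
  by (simp add: continuous_intros)

lemma norm_add_square_le:
  fixes a b :: "'b::real_inner"
  shows "(norm (a + b))\<^sup>2 \<le> 2 * (norm a)\<^sup>2 + 2 * (norm b)\<^sup>2"
  using zero_le_power2[of "norm (a - b)"]
  unfolding power2_norm_eq_inner by (simp add: inner_add inner_diff inner_commute)

text \<open>A discrete-time model of Brownian increments along a grid. It records what the estimates
  draw on: \<open>\<xi> k\<close> is known at time \<open>Suc k\<close>, independent of the past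
  \<open>F k\<close>, centred, and of second moment at most \<open>v\<close>.\<close>

locale adapted_noise = prob_space M for M :: "'a measure" +
  fixes F :: "nat \<Rightarrow> 'a measure" and \<xi> :: "nat \<Rightarrow> 'a \<Rightarrow> real^'m" and v :: real
  assumes subalg: "subalgebra M (F k)"
    and filtration_mono: "k \<le> l \<Longrightarrow> sets (F k) \<subseteq> sets (F l)"
    and noise_measurable: "\<xi> k \<in> borel_measurable (F (Suc k))"
    and noise_indep: "indep_set (sets (F k)) {\<xi> k -` A \<inter> space M | A. A \<in> sets borel}"
    and noise_mean: "expectation (\<lambda>\<omega>. \<xi> k \<omega> $ i) = 0"
    and noise_integrable: "integrable M (\<lambda>\<omega>. (norm (\<xi> k \<omega>))\<^sup>2)"
    and noise_variance: "expectation (\<lambda>\<omega>. (norm (\<xi> k \<omega>))\<^sup>2) \<le> v"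
begin

lemma measurable_M: "f \<in> measurable (F k) N \<Longrightarrow> f \<in> measurable M N"
  using measurable_from_subalg[OF subalg] .

lemma measurable_F_mono:
  assumes "f \<in> measurable (F k) N" "k \<le> l" shows "f \<in> measurable (F l) N"
proof -
  have "subalgebra (F l) (F k)"
    using subalg[of k] subalg[of l] filtration_mono[OF assms(2)] by (simp add: subalgebra_def)
  then show ?thesis using assms(1) by (rule measurable_from_subalg)
qed

lemma noise_measurable_M: "\<xi> k \<in> borel_measurable M"
  using measurable_M[OF noise_measurable] .

text \<open>Bridge from independence of set families to \<open>indep_var\<close>, for which
  expectations of products factor. Both families are closed under intersection, so independence
  extends to the generated sigma-algebras and then passes down to those of \<open>V\<close> and
  \<open>f (\<xi> k)\<close>.\<close>

lemma indep_var_noise: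
  fixes V :: "'a \<Rightarrow> real" and f :: "real^'m \<Rightarrow> real"
  assumes V: "V \<in> borel_measurable (F k)" and f: "f \<in> borel_measurable borel"
  shows "indep_var borel V borel (\<lambda>\<omega>. f (\<xi> k \<omega>))"
proof -
  let ?B = "{\<xi> k -` A \<inter> space M | A. A \<in> sets borel}"
  have sp: "space (F k) = space M" using subalg[of k] by (simp add: subalgebra_def)
  have IA: "Int_stable (sets (F k))" by (auto simp: Int_stable_def)
  have IB: "Int_stable ?B"
    unfolding Int_stable_def
  proof (intro ballI)
    fix a b assume "a \<in> ?B" "b \<in> ?B"
    then obtain A B where "A \<in> sets borel" "B \<in> sets borel"
      "a = \<xi> k -` A \<inter> space M" "b = \<xi> k -` B \<inter> space M" by auto
    then show "a \<inter> b \<in> ?B"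
      by (intro CollectI exI[of _ "A \<inter> B"]) auto
  qed
  have ind: "indep_set (sigma_sets (space M) (sets (F k))) (sigma_sets (space M) ?B)"
    by (rule indep_set_sigma_sets[OF noise_indep IA IB])
  have sub1: "{V -` A \<inter> space M | A. A \<in> sets borel} \<subseteq> sets (F k)"
    using measurable_sets[OF V] by (auto simp: sp)
  have sub2: "{(\<lambda>\<omega>. f (\<xi> k \<omega>)) -` A \<inter> space M | A. A \<in> sets borel} \<subseteq> ?B"
  proof clarify
    fix A :: "real set" assume "A \<in> sets borel"
    then have "f -` A \<in> sets borel" using measurable_sets[OF f, of A] by simp
    then show "\<exists>B. (\<lambda>\<omega>. f (\<xi> k \<omega>)) -` A \<inter> space M = \<xi> k -` B \<inter> space M \<and> B \<in> sets borel"
      by (intro exI[of _ "f -` A"]) auto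
  qed
  have "indep_set (sigma_sets (space M) {V -` A \<inter> space M | A. A \<in> sets borel})
      (sigma_sets (space M) {(\<lambda>\<omega>. f (\<xi> k \<omega>)) -` A \<inter> space M | A. A \<in> sets borel})"
    using ind sigma_sets_mono'[OF sub1] sigma_sets_mono'[OF sub2]
    unfolding indep_set_def
    by (elim indep_sets_mono_sets) (auto split: bool.split)
  then show ?thesis
    unfolding indep_var_eq
    using measurable_M[OF V] measurable_compose[OF noise_measurable_M f] by auto
qed

lemma noise_component_integrable: "integrable M (\<lambda>\<omega>. \<xi> k \<omega> $ i)"
proof (rule Bochner_Integration.integrable_bound)
  show "integrable M (\<lambda>\<omega>. 1 + (norm (\<xi> k \<omega>))\<^sup>2)"
    using noise_integrable by simp
  show "(\<lambda>\<omega>. \<xi> k \<omega> $ i) \<in> borel_measurable M"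
    by (rule borel_measurable_vec_nth_comp[OF noise_measurable_M])
  have "\<bar>\<xi> k \<omega> $ i\<bar> \<le> 1 + (norm (\<xi> k \<omega>))\<^sup>2" for \<omega>
  proof -
    have "\<bar>\<xi> k \<omega> $ i\<bar> \<le> norm (\<xi> k \<omega>)" by (rule component_le_norm_cart)
    moreover have "norm (\<xi> k \<omega>) \<le> 1 + (norm (\<xi> k \<omega>))\<^sup>2"
      using zero_le_power2[of "norm (\<xi> k \<omega>) - 1/2"] by (simp add: power2_eq_square algebra_simps)
    ultimately show ?thesis by linarith
  qed
  then show "AE x in M. norm (\<xi> k x $ i) \<le> norm (1 + (norm (\<xi> k x))\<^sup>2)"
    by (intro AE_I2) (simp add: abs_of_nonneg)
qed

text \<open>In coordinates the inner product is a sum of terms \<open>V j\<close> times the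
  \<open>j\<close>-th coordinate of the noise, with \<open>V j\<close> known at time
  \<open>k\<close>; independence factors each expectation, and the noise is centred. Asking only
  integrability of \<open>u\<close> admits the unbounded partial sums of the noise.\<close>

lemma noise_orthogonal:
  fixes u :: "'a \<Rightarrow> real^'d" and h :: "'a \<Rightarrow> real^'m^'d"
  assumes u: "u \<in> borel_measurable (F k)" "integrable M (\<lambda>\<omega>. norm (u \<omega>))"
    and h: "h \<in> borel_measurable (F k)" "\<And>\<omega>. norm (h \<omega>) \<le> K"
  shows "integrable M (\<lambda>\<omega>. u \<omega> \<bullet> (h \<omega> *v \<xi> k \<omega>))"
    and "expectation (\<lambda>\<omega>. u \<omega> \<bullet> (h \<omega> *v \<xi> k \<omega>)) = 0"
proof -
  define V where "V j \<omega> = (\<Sum>i\<in>UNIV. u \<omega> $ i * h \<omega> $ i $ j)" for j \<omega>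
  have V_meas: "V j \<in> borel_measurable (F k)" for j
    unfolding V_def
    by (intro borel_measurable_sum borel_measurable_times borel_measurable_vec_nth_comp u h)
  have K0: "0 \<le> K" using h(2)[of undefined] norm_ge_zero order_trans by blast
  have V_bound: "\<bar>V j \<omega>\<bar> \<le> real CARD('d) * K * norm (u \<omega>)" for j \<omega>
  proof -
    have "\<bar>V j \<omega>\<bar> \<le> (\<Sum>i\<in>UNIV. \<bar>u \<omega> $ i\<bar> * \<bar>h \<omega> $ i $ j\<bar>)"
      unfolding V_def abs_mult[symmetric] by (rule sum_abs)
    also have "\<dots> \<le> (\<Sum>i\<in>(UNIV::'d set). norm (u \<omega>) * K)"
    proof (intro sum_mono mult_mono component_le_norm_cart)
      fix i
      have "\<bar>h \<omega> $ i $ j\<bar> \<le> norm (h \<omega> $ i)" by (rule component_le_norm_cart)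
      also have "\<dots> \<le> norm (h \<omega>)" by (rule Finite_Cartesian_Product.norm_nth_le)
      finally show "\<bar>h \<omega> $ i $ j\<bar> \<le> K" using h(2)[of \<omega>] by simp
    qed auto
    finally show ?thesis by (simp add: mult_ac)
  qed
  have V_int: "integrable M (V j)" for j
  proof (rule Bochner_Integration.integrable_bound)
    show "integrable M (\<lambda>\<omega>. real CARD('d) * K * norm (u \<omega>))" using u by simp
    show "V j \<in> borel_measurable M" by (rule measurable_M[OF V_meas])
    show "AE x in M. norm (V j x) \<le> norm (real CARD('d) * K * norm (u x))"
      using V_bound[of j] K0 by (intro AE_I2) (simp add: abs_mult)
  qed
  have ind: "indep_var borel (V j) borel (\<lambda>\<omega>. \<xi> k \<omega> $ j)" for j
    by (rule indep_var_noise[OF V_meas]) (simp add: borel_measurable_vec_nth_comp)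
  have int: "integrable M (\<lambda>\<omega>. V j \<omega> * \<xi> k \<omega> $ j)" for j
    by (rule indep_var_integrable[OF ind V_int noise_component_integrable])
  have ex: "expectation (\<lambda>\<omega>. V j \<omega> * \<xi> k \<omega> $ j) = 0" for j
    using indep_var_lebesgue_integral[OF ind V_int noise_component_integrable]
    by (simp add: noise_mean)
  have eq: "u \<omega> \<bullet> (h \<omega> *v \<xi> k \<omega>) = (\<Sum>j\<in>UNIV. V j \<omega> * \<xi> k \<omega> $ j)" for \<omega>
    unfolding V_def inner_vec_def matrix_vector_mult_def
    by (simp add: sum_distrib_left sum_distrib_right mult_ac) (rule sum.swap)
  show "integrable M (\<lambda>\<omega>. u \<omega> \<bullet> (h \<omega> *v \<xi> k \<omega>))"
    unfolding eq by (intro Bochner_Integration.integrable_sum int)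
  show "expectation (\<lambda>\<omega>. u \<omega> \<bullet> (h \<omega> *v \<xi> k \<omega>)) = 0"
    unfolding eq using int ex by (subst Bochner_Integration.integral_sum) auto
qed

text \<open>The norm inequality for matrix-vector products leaves
  \<open>w * (norm h)\<^sup>2\<close>, known at time \<open>k\<close>, times the squared noise, and
  independence factors the expectation. The weight \<open>w\<close> will be the slope of the
  Lyapunov function at an earlier time.\<close>

lemma noise_square:
  fixes h :: "'a \<Rightarrow> real^'m^'d" and w :: "'a \<Rightarrow> real"
  assumes h: "h \<in> borel_measurable (F k)" "\<And>\<omega>. norm (h \<omega>) \<le> K"
    and w: "w \<in> borel_measurable (F k)" "\<And>\<omega>. 0 \<le> w \<omega>" "\<And>\<omega>. w \<omega> \<le> c"
  shows "integrable M (\<lambda>\<omega>. w \<omega> * (norm (h \<omega> *v \<xi> k \<omega>))\<^sup>2)"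
    and "expectation (\<lambda>\<omega>. w \<omega> * (norm (h \<omega> *v \<xi> k \<omega>))\<^sup>2)
      \<le> expectation (\<lambda>\<omega>. w \<omega> * (v * (norm (h \<omega>))\<^sup>2))"
proof -
  define V where "V \<omega> = w \<omega> * (norm (h \<omega>))\<^sup>2" for \<omega>
  have V_meas: "V \<in> borel_measurable (F k)"
    unfolding V_def using h w by measurable
  have V0: "0 \<le> V \<omega>" for \<omega> by (simp add: V_def w)
  have V_bd: "V \<omega> \<le> c * K\<^sup>2" for \<omega>
    unfolding V_def using w(2)[of \<omega>] w(3)[of \<omega>] h(2)[of \<omega>]
    by (intro mult_mono power_mono) auto
  have V_int: "integrable M V"
    using V_bd V0 measurable_M[OF V_meas]
    by (intro integrable_const_bound[where B="c * K\<^sup>2"]) auto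
  have ind: "indep_var borel V borel (\<lambda>\<omega>. (norm (\<xi> k \<omega>))\<^sup>2)"
    by (rule indep_var_noise[OF V_meas]) simp
  have int: "integrable M (\<lambda>\<omega>. V \<omega> * (norm (\<xi> k \<omega>))\<^sup>2)"
    by (rule indep_var_integrable[OF ind V_int noise_integrable])
  have le: "w \<omega> * (norm (h \<omega> *v \<xi> k \<omega>))\<^sup>2 \<le> V \<omega> * (norm (\<xi> k \<omega>))\<^sup>2" for \<omega>
  proof -
    have "(norm (h \<omega> *v \<xi> k \<omega>))\<^sup>2 \<le> (norm (h \<omega>) * norm (\<xi> k \<omega>))\<^sup>2"
      by (intro power_mono norm_matrix_vector_mult_le) auto
    then show ?thesis
      using mult_left_mono[OF _ w(2)] by (simp add: V_def power_mult_distrib mult.assoc)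
  qed
  show int': "integrable M (\<lambda>\<omega>. w \<omega> * (norm (h \<omega> *v \<xi> k \<omega>))\<^sup>2)"
  proof (rule Bochner_Integration.integrable_bound[OF int])
    show "(\<lambda>\<omega>. w \<omega> * (norm (h \<omega> *v \<xi> k \<omega>))\<^sup>2) \<in> borel_measurable M"
      using measurable_M[OF w(1)]
        borel_measurable_matrix_vector_mult[OF measurable_M[OF h(1)] noise_measurable_M]
      by measurable
    show "AE x in M. norm (w x * (norm (h x *v \<xi> k x))\<^sup>2) \<le> norm (V x * (norm (\<xi> k x))\<^sup>2)"
      using le V0 w by (intro AE_I2) (simp add: abs_mult)
  qed
  have "expectation (\<lambda>\<omega>. w \<omega> * (norm (h \<omega> *v \<xi> k \<omega>))\<^sup>2)
      \<le> expectation (\<lambda>\<omega>. V \<omega> * (norm (\<xi> k \<omega>))\<^sup>2)"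
    by (rule integral_mono[OF int' int le])
  also have "\<dots> = expectation V * expectation (\<lambda>\<omega>. (norm (\<xi> k \<omega>))\<^sup>2)"
    by (rule indep_var_lebesgue_integral[OF ind V_int noise_integrable])
  also have "\<dots> \<le> expectation V * v"
    using V0 by (intro mult_left_mono noise_variance integral_nonneg_AE) auto
  also have "\<dots> = expectation (\<lambda>\<omega>. w \<omega> * (v * (norm (h \<omega>))\<^sup>2))"
    unfolding V_def by (simp add: mult_ac flip: integral_mult_right_zero)
  finally show "expectation (\<lambda>\<omega>. w \<omega> * (norm (h \<omega> *v \<xi> k \<omega>))\<^sup>2)
      \<le> expectation (\<lambda>\<omega>. w \<omega> * (v * (norm (h \<omega>))\<^sup>2))" .
qed

lemma noise_sum_measurable:
  fixes h :: "nat \<Rightarrow> 'a \<Rightarrow> real^'m^'d"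
  assumes h: "\<And>k. h k \<in> borel_measurable (F k)"
  shows "(\<lambda>\<omega>. \<Sum>k\<in>{p..<q}. h k \<omega> *v \<xi> k \<omega>) \<in> borel_measurable (F q)"
proof (intro borel_measurable_sum borel_measurable_matrix_vector_mult)
  fix k assume "k \<in> {p..<q}"
  then have "k \<le> q" "Suc k \<le> q" by auto
  then show "h k \<in> borel_measurable (F q)" "\<xi> k \<in> borel_measurable (F q)"
    using measurable_F_mono[OF h] measurable_F_mono[OF noise_measurable] by auto
qed

lemma integrable_norm_of_square:
  fixes f :: "'a \<Rightarrow> 'b::euclidean_space"
  assumes "f \<in> borel_measurable M" "integrable M (\<lambda>\<omega>. (norm (f \<omega>))\<^sup>2)"
  shows "integrable M (\<lambda>\<omega>. norm (f \<omega>))"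
proof (rule Bochner_Integration.integrable_bound)
  show "integrable M (\<lambda>\<omega>. 1 + (norm (f \<omega>))\<^sup>2)" using assms by simp
  show "(\<lambda>\<omega>. norm (f \<omega>)) \<in> borel_measurable M" using assms by measurable
  have "norm (f \<omega>) \<le> 1 + (norm (f \<omega>))\<^sup>2" for \<omega>
    using zero_le_power2[of "norm (f \<omega>) - 1/2"] by (simp add: power2_eq_square algebra_simps)
  then show "AE x in M. norm (norm (f x)) \<le> norm (1 + (norm (f x))\<^sup>2)"
    by (intro AE_I2) (simp add: abs_of_nonneg)
qed

text \<open>The sharp constant of the Ito isometry is replaced by the bound \<open>v\<close> of \<open>E|\<xi>|\<^sup>2\<close>, which avoids covariances.\<close>

lemma noise_sum_square:
  fixes h :: "nat \<Rightarrow> 'a \<Rightarrow> real^'m^'d" and w :: "'a \<Rightarrow> real"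
  assumes h: "\<And>k. h k \<in> borel_measurable (F k)" "\<And>k \<omega>. norm (h k \<omega>) \<le> K"
    and w: "w \<in> borel_measurable (F p)" "\<And>\<omega>. 0 \<le> w \<omega>" "\<And>\<omega>. w \<omega> \<le> c"
    and "p \<le> q"
  shows "integrable M (\<lambda>\<omega>. (norm (\<Sum>k\<in>{p..<q}. h k \<omega> *v \<xi> k \<omega>))\<^sup>2) \<and>
    expectation (\<lambda>\<omega>. w \<omega> * (norm (\<Sum>k\<in>{p..<q}. h k \<omega> *v \<xi> k \<omega>))\<^sup>2)
      \<le> expectation (\<lambda>\<omega>. w \<omega> * (\<Sum>k\<in>{p..<q}. v * (norm (h k \<omega>))\<^sup>2))"
  using \<open>p \<le> q\<close>
proof (induction q rule: dec_induct)
  case base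
  then show ?case by simp
next
  case (step q)
  let ?S = "\<lambda>\<omega>. \<Sum>k\<in>{p..<q}. h k \<omega> *v \<xi> k \<omega>"
  let ?D = "\<lambda>\<omega>. h q \<omega> *v \<xi> q \<omega>"
  have wq: "w \<in> borel_measurable (F q)" by (rule measurable_F_mono[OF w(1) step(1)])
  have S_meas: "?S \<in> borel_measurable (F q)" by (rule noise_sum_measurable[OF h(1)])
  have S_sq: "integrable M (\<lambda>\<omega>. (norm (?S \<omega>))\<^sup>2)" using step.IH by simp
  have S_int: "integrable M (\<lambda>\<omega>. norm (?S \<omega>))"
    by (rule integrable_norm_of_square[OF measurable_M[OF S_meas] S_sq])
  have D_meas: "?D \<in> borel_measurable M"
    by (rule borel_measurable_matrix_vector_mult[OF measurable_M[OF h(1)] noise_measurable_M])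
  have D_sq: "integrable M (\<lambda>\<omega>. (norm (?D \<omega>))\<^sup>2)"
    using noise_square(1)[OF h(1)[of q] h(2), where w="\<lambda>_. 1" and c=1] by simp
  have c0: "0 \<le> c" using w(2,3) order_trans by blast
  have split: "(\<Sum>k\<in>{p..<Suc q}. h k \<omega> *v \<xi> k \<omega>) = ?S \<omega> + ?D \<omega>" for \<omega>
    using step(1) by simp
  have sq_int: "integrable M (\<lambda>\<omega>. (norm (?S \<omega> + ?D \<omega>))\<^sup>2)"
  proof (rule Bochner_Integration.integrable_bound)
    show "integrable M (\<lambda>\<omega>. 2 * (norm (?S \<omega>))\<^sup>2 + 2 * (norm (?D \<omega>))\<^sup>2)"
      using S_sq D_sq by simp
    show "(\<lambda>\<omega>. (norm (?S \<omega> + ?D \<omega>))\<^sup>2) \<in> borel_measurable M"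
      using measurable_M[OF S_meas] D_meas by measurable
    show "AE \<omega> in M. norm ((norm (?S \<omega> + ?D \<omega>))\<^sup>2)
        \<le> norm (2 * (norm (?S \<omega>))\<^sup>2 + 2 * (norm (?D \<omega>))\<^sup>2)"
      using norm_add_square_le by (intro AE_I2) (simp add: abs_of_nonneg)
  qed
  have wS_int: "integrable M (\<lambda>\<omega>. norm ((2 * w \<omega>) *\<^sub>R ?S \<omega>))"
  proof (rule Bochner_Integration.integrable_bound)
    show "integrable M (\<lambda>\<omega>. 2 * c * norm (?S \<omega>))" using S_int by simp
    show "(\<lambda>\<omega>. norm ((2 * w \<omega>) *\<^sub>R ?S \<omega>)) \<in> borel_measurable M"
      using measurable_M[OF S_meas] measurable_M[OF wq] by measurable
    show "AE \<omega> in M. norm (norm ((2 * w \<omega>) *\<^sub>R ?S \<omega>)) \<le> norm (2 * c * norm (?S \<omega>))"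
      using w c0 by (intro AE_I2) (auto simp: abs_mult intro!: mult_right_mono)
  qed
  have wS_meas: "(\<lambda>\<omega>. (2 * w \<omega>) *\<^sub>R ?S \<omega>) \<in> borel_measurable (F q)"
    using S_meas wq by measurable
  \<comment> \<open>The old part, including its weight, is known at time \<open>q\<close>, so the
    cross term of the expanded square has mean zero.\<close>
  note cross = noise_orthogonal[OF wS_meas wS_int h(1) h(2)]
  note sq = noise_square[OF h(1) h(2) wq w(2) w(3)]
  have wS2: "integrable M (\<lambda>\<omega>. w \<omega> * (norm (?S \<omega>))\<^sup>2)"
  proof (rule Bochner_Integration.integrable_bound)
    show "integrable M (\<lambda>\<omega>. c * (norm (?S \<omega>))\<^sup>2)" using S_sq by simp
    show "(\<lambda>\<omega>. w \<omega> * (norm (?S \<omega>))\<^sup>2) \<in> borel_measurable M"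
      using measurable_M[OF S_meas] measurable_M[OF wq] by measurable
    show "AE \<omega> in M. norm (w \<omega> * (norm (?S \<omega>))\<^sup>2) \<le> norm (c * (norm (?S \<omega>))\<^sup>2)"
      using w c0 by (intro AE_I2) (auto simp: abs_mult intro!: mult_right_mono)
  qed
  have wh_int: "integrable M (\<lambda>\<omega>. w \<omega> * (v * (norm (h k \<omega>))\<^sup>2))" if "p \<le> k" for k
  proof -
    have "integrable M (\<lambda>\<omega>. w \<omega> * (norm (h k \<omega>))\<^sup>2)"
    proof (rule integrable_const_bound[where B="c * K\<^sup>2"])
      show "AE \<omega> in M. norm (w \<omega> * (norm (h k \<omega>))\<^sup>2) \<le> c * K\<^sup>2"
        using w h(2) c0 by (intro AE_I2) (auto simp: abs_mult intro!: mult_mono power_mono)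
      show "(\<lambda>\<omega>. w \<omega> * (norm (h k \<omega>))\<^sup>2) \<in> borel_measurable M"
        using measurable_M[OF h(1)] measurable_M[OF wq] by measurable
    qed
    then have "integrable M (\<lambda>\<omega>. v * (w \<omega> * (norm (h k \<omega>))\<^sup>2))" by simp
    then show ?thesis by (simp add: mult_ac)
  qed
  have expand: "w \<omega> * (norm (?S \<omega> + ?D \<omega>))\<^sup>2 =
      w \<omega> * (norm (?S \<omega>))\<^sup>2 + ((2 * w \<omega>) *\<^sub>R ?S \<omega>) \<bullet> ?D \<omega> + w \<omega> * (norm (?D \<omega>))\<^sup>2" for \<omega>
    by (simp add: power2_norm_eq_inner inner_add inner_commute algebra_simps)
  have "expectation (\<lambda>\<omega>. w \<omega> * (norm (?S \<omega> + ?D \<omega>))\<^sup>2)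
      = expectation (\<lambda>\<omega>. w \<omega> * (norm (?S \<omega>))\<^sup>2) + expectation (\<lambda>\<omega>. w \<omega> * (norm (?D \<omega>))\<^sup>2)"
    unfolding expand using wS2 cross sq(1) by simp
  also have "\<dots> \<le> expectation (\<lambda>\<omega>. w \<omega> * (\<Sum>k\<in>{p..<q}. v * (norm (h k \<omega>))\<^sup>2))
      + expectation (\<lambda>\<omega>. w \<omega> * (v * (norm (h q \<omega>))\<^sup>2))"
    using step.IH sq(2) by (intro add_mono) auto
  also have "\<dots> = expectation (\<lambda>\<omega>. w \<omega> * (\<Sum>k\<in>{p..<q}. v * (norm (h k \<omega>))\<^sup>2)
      + w \<omega> * (v * (norm (h q \<omega>))\<^sup>2))"
    using wh_int step(1)
    by (intro Bochner_Integration.integral_add[symmetric])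
      (auto simp: sum_distrib_left intro!: Bochner_Integration.integrable_sum)
  also have "\<dots> = expectation (\<lambda>\<omega>. w \<omega> * (\<Sum>k\<in>{p..<Suc q}. v * (norm (h k \<omega>))\<^sup>2))"
    using step(1) by (simp add: algebra_simps)
  finally show ?case unfolding split using sq_int by simp
qed

text \<open>Concavity is applied once to the whole block from \<open>p\<close> to \<open>q\<close>,
  with slope frozen at \<open>Z p\<close>. The term linear in the noise has mean zero, its square is
  controlled by \<open>noise_sum_square\<close>, and \<open>drift\<close> bounds that contribution
  together with the linear drift term. What remains is the squared drift increment, quadratic in the
  block length \<open>d * real (q - p)\<close>; over \<open>N\<close> equal blocks of a fixed
  interval these errors add up to order \<open>1 / N\<close>.\<close>

lemma lyapunov_block:
  fixes h :: "nat \<Rightarrow> 'a \<Rightarrow> real^'m^'d" and \<beta> :: "nat \<Rightarrow> 'a \<Rightarrow> real^'d" and z0 :: "real^'d"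
    and g \<rho> :: "real \<Rightarrow> real" and d :: real
  defines "Z \<equiv> \<lambda>q \<omega>. z0 + (\<Sum>k<q. h k \<omega> *v \<xi> k \<omega> + d *\<^sub>R \<beta> k \<omega>)"
  assumes h: "\<And>k. h k \<in> borel_measurable (F k)" "\<And>k \<omega>. norm (h k \<omega>) \<le> K"
    and \<beta>: "\<And>k. \<beta> k \<in> borel_measurable (F k)" "\<And>k \<omega>. norm (\<beta> k \<omega>) \<le> K"
    and d: "0 \<le> d" and pq: "p \<le> q"
    and g: "mono g" "g 0 = 0"
    and \<rho>: "\<rho> \<in> borel_measurable borel" "\<And>x. 0 \<le> \<rho> x" "\<And>x. \<rho> x \<le> c"
    and concave: "\<And>x y. 0 \<le> x \<Longrightarrow> 0 \<le> y \<Longrightarrow> g y \<le> g x + \<rho> x * (y - x)"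
    and drift: "\<And>k \<omega>. p \<le> k \<Longrightarrow> k < q \<Longrightarrow> \<omega> \<in> space M \<Longrightarrow>
      \<rho> ((norm (Z p \<omega>))\<^sup>2) * (2 * d * (Z p \<omega> \<bullet> \<beta> k \<omega>) + 2 * (v * (norm (h k \<omega>))\<^sup>2)) \<le> L * d"
  shows "integrable M (\<lambda>\<omega>. g ((norm (Z q \<omega>))\<^sup>2))"
    and "expectation (\<lambda>\<omega>. g ((norm (Z q \<omega>))\<^sup>2))
    \<le> expectation (\<lambda>\<omega>. g ((norm (Z p \<omega>))\<^sup>2)) + L * (d * real (q - p))
      + 2 * c * (K * (d * real (q - p)))\<^sup>2"
proof -
  \<comment> \<open>\<open>S\<close> is the noise part and \<open>A\<close> the drift part of the
    increment between two indices.\<close>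
  define S where "S p q \<omega> = (\<Sum>k\<in>{p..<q}. h k \<omega> *v \<xi> k \<omega>)" for p q \<omega>
  define A where "A p q \<omega> = (\<Sum>k\<in>{p..<q}. d *\<^sub>R \<beta> k \<omega>)" for p q \<omega>
  define w where "w \<omega> = \<rho> ((norm (Z p \<omega>))\<^sup>2)" for \<omega>
  have c0: "0 \<le> c" using \<rho>(2,3) order_trans by blast
  have K0: "0 \<le> K" using h(2)[of 0 undefined] norm_ge_zero order_trans by blast
  have Z_eq: "Z q \<omega> = z0 + S 0 q \<omega> + A 0 q \<omega>" for q \<omega>
    by (simp add: Z_def S_def A_def sum.distrib atLeast0LessThan algebra_simps)
  have S_meas: "S p q \<in> borel_measurable (F q)" for p q
    unfolding S_def by (rule noise_sum_measurable[OF h(1)])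
  have A_meas: "A p q \<in> borel_measurable (F q)" for p q
    unfolding A_def
    by (intro borel_measurable_sum borel_measurable_scaleR borel_measurable_const
        measurable_F_mono[OF \<beta>(1)]) auto
  have A_bound: "norm (A p q \<omega>) \<le> K * (d * real (q - p))" for p q \<omega>
  proof -
    have "norm (A p q \<omega>) \<le> (\<Sum>k\<in>{p..<q}. d * K)"
      unfolding A_def using d \<beta>(2) by (intro sum_norm_le) (auto intro!: mult_left_mono)
    then show ?thesis by (simp add: mult_ac)
  qed
  \<comment> \<open>Only the integrability conjunct is wanted, so the weight is set to 0.\<close>
  have S_sq: "integrable M (\<lambda>\<omega>. (norm (S p q \<omega>))\<^sup>2)" if "p \<le> q" for p q
    using noise_sum_square[OF h(1) h(2), where w="\<lambda>_. 0" and p=p and c=0 and q=q] that unfolding S_def by simp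
  have Z_meas: "Z q \<in> borel_measurable (F q)" for q
  proof -
    have "(\<lambda>\<omega>. z0 + S 0 q \<omega> + A 0 q \<omega>) \<in> borel_measurable (F q)"
      using S_meas[of 0 q] A_meas[of 0 q] by measurable
    then show ?thesis by (simp add: Z_eq[abs_def])
  qed
  have Z_sq: "integrable M (\<lambda>\<omega>. (norm (Z q \<omega>))\<^sup>2)" for q
  proof (rule Bochner_Integration.integrable_bound)
    let ?B = "norm z0 + K * (d * real (q - 0))"
    show "integrable M (\<lambda>\<omega>. 2 * (norm (S 0 q \<omega>))\<^sup>2 + 2 * ?B\<^sup>2)"
      using S_sq[of 0 q] by simp
    show "(\<lambda>\<omega>. (norm (Z q \<omega>))\<^sup>2) \<in> borel_measurable M"
      using measurable_M[OF Z_meas] by measurable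
    have "(norm (Z q \<omega>))\<^sup>2 \<le> 2 * (norm (S 0 q \<omega>))\<^sup>2 + 2 * ?B\<^sup>2" for \<omega>
    proof -
      have "norm (z0 + A 0 q \<omega>) \<le> ?B"
        using norm_triangle_ineq[of z0 "A 0 q \<omega>"] A_bound[of 0 q \<omega>] by linarith
      then have "(norm (z0 + A 0 q \<omega>))\<^sup>2 \<le> ?B\<^sup>2" by (intro power_mono) auto
      then show ?thesis
        using norm_add_square_le[of "S 0 q \<omega>" "z0 + A 0 q \<omega>"]
        unfolding Z_eq by (simp add: algebra_simps)
    qed
    then show "AE \<omega> in M. norm ((norm (Z q \<omega>))\<^sup>2) \<le> norm (2 * (norm (S 0 q \<omega>))\<^sup>2 + 2 * ?B\<^sup>2)"
      by (intro AE_I2) (simp add: abs_of_nonneg)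
  qed
  have Z_int: "integrable M (\<lambda>\<omega>. norm (Z q \<omega>))" for q
    by (rule integrable_norm_of_square[OF measurable_M[OF Z_meas] Z_sq])
  have g0: "0 \<le> g x" if "0 \<le> x" for x using monoD[OF g(1) that] g(2) by simp
  have g_int: "integrable M (\<lambda>\<omega>. g ((norm (Z q \<omega>))\<^sup>2))" for q
  proof (rule Bochner_Integration.integrable_bound)
    show "integrable M (\<lambda>\<omega>. c * (norm (Z q \<omega>))\<^sup>2)" using Z_sq by simp
    have [measurable]: "g \<in> borel_measurable borel" using g(1) by (rule borel_measurable_mono)
    have [measurable]: "Z q \<in> borel_measurable M" by (rule measurable_M[OF Z_meas])
    show "(\<lambda>\<omega>. g ((norm (Z q \<omega>))\<^sup>2)) \<in> borel_measurable M" by measurable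
    \<comment> \<open>Concavity at 0 and \<open>g 0 = 0\<close> give linear growth, so square
      integrability of \<open>Z q\<close> suffices.\<close>
    have "g ((norm (Z q \<omega>))\<^sup>2) \<le> c * (norm (Z q \<omega>))\<^sup>2" for \<omega>
    proof -
      have "g ((norm (Z q \<omega>))\<^sup>2) \<le> \<rho> 0 * (norm (Z q \<omega>))\<^sup>2"
        using concave[of 0 "(norm (Z q \<omega>))\<^sup>2"] g(2) by simp
      also have "\<dots> \<le> c * (norm (Z q \<omega>))\<^sup>2" using \<rho>(3) by (intro mult_right_mono) auto
      finally show ?thesis .
    qed
    then show "AE \<omega> in M. norm (g ((norm (Z q \<omega>))\<^sup>2)) \<le> norm (c * (norm (Z q \<omega>))\<^sup>2)"
      using g0 c0 by (intro AE_I2) (simp add: abs_mult)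
  qed
  have w: "w \<in> borel_measurable (F p)" "\<And>\<omega>. 0 \<le> w \<omega>" "\<And>\<omega>. w \<omega> \<le> c"
  proof -
    have [measurable]: "Z p \<in> borel_measurable (F p)" by (rule Z_meas)
    show "w \<in> borel_measurable (F p)" unfolding w_def using \<rho>(1) by measurable
  qed (auto simp: w_def \<rho>)
  let ?u = "\<lambda>\<omega>. (2 * w \<omega>) *\<^sub>R Z p \<omega>"
  have u_meas: "?u \<in> borel_measurable (F p)" using w(1) Z_meas[of p] by measurable
  have u_int: "integrable M (\<lambda>\<omega>. norm (?u \<omega>))"
  proof (rule Bochner_Integration.integrable_bound)
    show "integrable M (\<lambda>\<omega>. 2 * c * norm (Z p \<omega>))" using Z_int by simp
    show "(\<lambda>\<omega>. norm (?u \<omega>)) \<in> borel_measurable M" using measurable_M[OF u_meas] by measurable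
    show "AE \<omega> in M. norm (norm (?u \<omega>)) \<le> norm (2 * c * norm (Z p \<omega>))"
      using w c0 by (intro AE_I2) (auto simp: abs_mult intro!: mult_right_mono)
  qed
  have cross_int: "integrable M (\<lambda>\<omega>. ?u \<omega> \<bullet> (h k \<omega> *v \<xi> k \<omega>))"
    and cross_zero: "expectation (\<lambda>\<omega>. ?u \<omega> \<bullet> (h k \<omega> *v \<xi> k \<omega>)) = 0" if "p \<le> k" for k
    using noise_orthogonal[OF measurable_F_mono[OF u_meas that] u_int h(1) h(2)] by auto
  have uS: "?u \<omega> \<bullet> S p q \<omega> = (\<Sum>k\<in>{p..<q}. ?u \<omega> \<bullet> (h k \<omega> *v \<xi> k \<omega>))" for \<omega>
    unfolding S_def by (rule inner_sum_right)
  have uS_int: "integrable M (\<lambda>\<omega>. ?u \<omega> \<bullet> S p q \<omega>)"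
    unfolding uS using cross_int by (intro Bochner_Integration.integrable_sum) auto
  have uS_zero: "expectation (\<lambda>\<omega>. ?u \<omega> \<bullet> S p q \<omega>) = 0"
    unfolding uS using cross_int cross_zero by (subst Bochner_Integration.integral_sum) auto
  let ?H = "\<lambda>\<omega>. \<Sum>k\<in>{p..<q}. v * (norm (h k \<omega>))\<^sup>2"
  have wS_int: "integrable M (\<lambda>\<omega>. w \<omega> * (norm (S p q \<omega>))\<^sup>2)"
  proof (rule Bochner_Integration.integrable_bound)
    show "integrable M (\<lambda>\<omega>. c * (norm (S p q \<omega>))\<^sup>2)" using S_sq[OF pq] by simp
    show "(\<lambda>\<omega>. w \<omega> * (norm (S p q \<omega>))\<^sup>2) \<in> borel_measurable M"
      using measurable_M[OF S_meas[of p q]] measurable_M[OF w(1)] by measurable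
    show "AE \<omega> in M. norm (w \<omega> * (norm (S p q \<omega>))\<^sup>2) \<le> norm (c * (norm (S p q \<omega>))\<^sup>2)"
      using w c0 by (intro AE_I2) (auto simp: abs_mult intro!: mult_right_mono)
  qed
  have wS_le: "expectation (\<lambda>\<omega>. w \<omega> * (norm (S p q \<omega>))\<^sup>2) \<le> expectation (\<lambda>\<omega>. w \<omega> * ?H \<omega>)"
    using noise_sum_square[OF h(1) h(2) w pq] unfolding S_def by simp
  have wH_int: "integrable M (\<lambda>\<omega>. w \<omega> * ?H \<omega>)"
  proof (rule integrable_const_bound[where B="c * (\<Sum>k\<in>{p..<q}. \<bar>v\<bar> * K\<^sup>2)"])
    have "\<bar>?H \<omega>\<bar> \<le> (\<Sum>k\<in>{p..<q}. \<bar>v\<bar> * K\<^sup>2)" for \<omega>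
      using h(2) by (intro order_trans[OF sum_abs] sum_mono)
        (auto simp: abs_mult intro!: mult_left_mono power_mono)
    then show "AE \<omega> in M. norm (w \<omega> * ?H \<omega>) \<le> c * (\<Sum>k\<in>{p..<q}. \<bar>v\<bar> * K\<^sup>2)"
      unfolding real_norm_def abs_mult using w c0
      by (intro AE_I2 mult_mono) auto
    have [measurable]: "h k \<in> borel_measurable M" for k by (rule measurable_M[OF h(1)])
    have [measurable]: "w \<in> borel_measurable M" by (rule measurable_M[OF w(1)])
    show "(\<lambda>\<omega>. w \<omega> * ?H \<omega>) \<in> borel_measurable M" by measurable
  qed
  have uA_int: "integrable M (\<lambda>\<omega>. ?u \<omega> \<bullet> A p q \<omega>)"
  proof (rule Bochner_Integration.integrable_bound)
    show "integrable M (\<lambda>\<omega>. K * (d * real (q - p)) * norm (?u \<omega>))" using u_int by simp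
    show "(\<lambda>\<omega>. ?u \<omega> \<bullet> A p q \<omega>) \<in> borel_measurable M"
      using measurable_M[OF u_meas] measurable_M[OF A_meas[of p q]] by measurable
    have "\<bar>?u \<omega> \<bullet> A p q \<omega>\<bar> \<le> K * (d * real (q - p)) * norm (?u \<omega>)" for \<omega>
      using Cauchy_Schwarz_ineq2[of "?u \<omega>" "A p q \<omega>"]
        mult_right_mono[OF A_bound[of p q \<omega>] norm_ge_zero[of "?u \<omega>"]] by (simp add: mult_ac)
    then show "AE \<omega> in M. norm (?u \<omega> \<bullet> A p q \<omega>) \<le> norm (K * (d * real (q - p)) * norm (?u \<omega>))"
      using K0 d by (intro AE_I2) (simp add: abs_mult)
  qed
  let ?E = "2 * c * (K * (d * real (q - p)))\<^sup>2"
  \<comment> \<open>The pathwise inequality: the tangent bound at \<open>Z p\<close>, the square of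
    \<open>S + A\<close> split into twice the two squares, and \<open>A\<close> estimated by the
    block length.\<close>
  have main: "g ((norm (Z q \<omega>))\<^sup>2) \<le>
      g ((norm (Z p \<omega>))\<^sup>2) + ?u \<omega> \<bullet> S p q \<omega> + ?u \<omega> \<bullet> A p q \<omega> + 2 * (w \<omega> * (norm (S p q \<omega>))\<^sup>2) + ?E"
    for \<omega>
  proof -
    have "{0..<q} = {0..<p} \<union> {p..<q}" "{0..<p} \<inter> {p..<q} = {}" using pq by auto
    then have Zq: "Z q \<omega> = Z p \<omega> + (S p q \<omega> + A p q \<omega>)"
      unfolding Z_eq S_def A_def by (simp add: sum.union_disjoint)
    have "(norm (Z q \<omega>))\<^sup>2 - (norm (Z p \<omega>))\<^sup>2
        = 2 * (Z p \<omega> \<bullet> S p q \<omega>) + 2 * (Z p \<omega> \<bullet> A p q \<omega>) + (norm (S p q \<omega> + A p q \<omega>))\<^sup>2"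
      unfolding Zq by (simp add: power2_norm_eq_inner inner_add inner_commute)
    also have "\<dots> \<le> 2 * (Z p \<omega> \<bullet> S p q \<omega>) + 2 * (Z p \<omega> \<bullet> A p q \<omega>) + 2 * (norm (S p q \<omega>))\<^sup>2
        + 2 * (norm (A p q \<omega>))\<^sup>2"
      using norm_add_square_le[of "S p q \<omega>" "A p q \<omega>"] by simp
    also have "\<dots> \<le> 2 * (Z p \<omega> \<bullet> S p q \<omega>) + 2 * (Z p \<omega> \<bullet> A p q \<omega>) + 2 * (norm (S p q \<omega>))\<^sup>2
        + 2 * (K * (d * real (q - p)))\<^sup>2"
      using power_mono[OF A_bound[of p q \<omega>] norm_ge_zero, of 2] by simp
    finally have "w \<omega> * ((norm (Z q \<omega>))\<^sup>2 - (norm (Z p \<omega>))\<^sup>2) \<le>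
      w \<omega> * (2 * (Z p \<omega> \<bullet> S p q \<omega>) + 2 * (Z p \<omega> \<bullet> A p q \<omega>) + 2 * (norm (S p q \<omega>))\<^sup>2
        + 2 * (K * (d * real (q - p)))\<^sup>2)"
      using w(2) by (rule mult_left_mono)
    moreover have "w \<omega> * (2 * (K * (d * real (q - p)))\<^sup>2) \<le> c * (2 * (K * (d * real (q - p)))\<^sup>2)"
      using w(3) by (intro mult_right_mono) auto
    moreover have "g ((norm (Z q \<omega>))\<^sup>2) \<le> g ((norm (Z p \<omega>))\<^sup>2)
        + w \<omega> * ((norm (Z q \<omega>))\<^sup>2 - (norm (Z p \<omega>))\<^sup>2)"
      unfolding w_def by (intro concave) auto
    ultimately show ?thesis by (simp add: algebra_simps)
  qed
  have "expectation (\<lambda>\<omega>. g ((norm (Z q \<omega>))\<^sup>2)) \<le> expectation (\<lambda>\<omega>.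
      g ((norm (Z p \<omega>))\<^sup>2) + ?u \<omega> \<bullet> S p q \<omega> + ?u \<omega> \<bullet> A p q \<omega> + 2 * (w \<omega> * (norm (S p q \<omega>))\<^sup>2) + ?E)"
    by (rule integral_mono[OF g_int _ main])
      (intro Bochner_Integration.integrable_add g_int uS_int uA_int integrable_mult_right wS_int
        integrable_const)
  also have "\<dots> = expectation (\<lambda>\<omega>. g ((norm (Z p \<omega>))\<^sup>2)) + expectation (\<lambda>\<omega>. ?u \<omega> \<bullet> A p q \<omega>)
      + 2 * expectation (\<lambda>\<omega>. w \<omega> * (norm (S p q \<omega>))\<^sup>2) + ?E"
    using g_int uS_int uA_int wS_int uS_zero by (simp add: prob_space del: inner_scaleR_left)
  also have "\<dots> \<le> expectation (\<lambda>\<omega>. g ((norm (Z p \<omega>))\<^sup>2)) + expectation (\<lambda>\<omega>. ?u \<omega> \<bullet> A p q \<omega>)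
      + 2 * expectation (\<lambda>\<omega>. w \<omega> * ?H \<omega>) + ?E"
    using wS_le by simp
  also have "\<dots> = expectation (\<lambda>\<omega>. g ((norm (Z p \<omega>))\<^sup>2))
      + expectation (\<lambda>\<omega>. ?u \<omega> \<bullet> A p q \<omega> + 2 * (w \<omega> * ?H \<omega>)) + ?E"
    using uA_int wH_int by (simp del: inner_scaleR_left)
  \<comment> \<open>Before taking expectations, the integrand is bounded pathwise by summing
    \<open>drift\<close> over the block.\<close>
  also have "expectation (\<lambda>\<omega>. ?u \<omega> \<bullet> A p q \<omega> + 2 * (w \<omega> * ?H \<omega>))
      \<le> expectation (\<lambda>\<omega>. L * (d * real (q - p)))"
  proof (rule integral_mono)
    fix \<omega> assume \<omega>: "\<omega> \<in> space M"
    have "?u \<omega> \<bullet> A p q \<omega> + 2 * (w \<omega> * ?H \<omega>)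
      = (\<Sum>k\<in>{p..<q}. \<rho> ((norm (Z p \<omega>))\<^sup>2) * (2 * d * (Z p \<omega> \<bullet> \<beta> k \<omega>) + 2 * (v * (norm (h k \<omega>))\<^sup>2)))"
      unfolding A_def w_def
      by (simp add: inner_sum_right sum_distrib_left sum.distrib algebra_simps)
    also have "\<dots> \<le> (\<Sum>k\<in>{p..<q}. L * d)" using drift \<omega> by (intro sum_mono) auto
    finally show "?u \<omega> \<bullet> A p q \<omega> + 2 * (w \<omega> * ?H \<omega>) \<le> L * (d * real (q - p))"
      by (simp add: mult_ac)
  qed (use uA_int wH_int in \<open>auto intro!: Bochner_Integration.integrable_add
      simp del: inner_scaleR_left\<close>)
  finally show "expectation (\<lambda>\<omega>. g ((norm (Z q \<omega>))\<^sup>2))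
    \<le> expectation (\<lambda>\<omega>. g ((norm (Z p \<omega>))\<^sup>2)) + L * (d * real (q - p))
      + 2 * c * (K * (d * real (q - p)))\<^sup>2"
    by (simp add: prob_space)
  show "integrable M (\<lambda>\<omega>. g ((norm (Z q \<omega>))\<^sup>2))" by (rule g_int)
qed

end

section \<open>Grids and Riemann sums\<close>

text \<open>Dominated convergence for indicators. It turns pathwise statements about continuous
  functions into vanishing probabilities without any uniformity in \<open>\<omega>\<close>.\<close>

lemma (in prob_space) prob_tendsto_zero:
  assumes A: "\<And>n. A n \<in> sets M"
    and ev: "\<And>\<omega>. \<omega> \<in> space M \<Longrightarrow> \<forall>\<^sub>F n in sequentially. \<omega> \<notin> A n"
  shows "(\<lambda>n. prob (A n)) \<longlonglongrightarrow> 0"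
proof -
  have "(\<lambda>n. expectation (indicator (A n) :: 'a \<Rightarrow> real)) \<longlonglongrightarrow> expectation (\<lambda>_. 0::real)"
  proof (rule integral_dominated_convergence[where w="\<lambda>_. 1"])
    show "AE \<omega> in M. (\<lambda>n. indicator (A n) \<omega> :: real) \<longlonglongrightarrow> 0"
    proof (intro AE_I2 tendsto_eventually)
      fix \<omega> assume "\<omega> \<in> space M"
      from ev[OF this] show "\<forall>\<^sub>F n in sequentially. indicator (A n) \<omega> = (0::real)"
        by eventually_elim simp
    qed
    show "AE \<omega> in M. norm (indicator (A n) \<omega> :: real) \<le> 1" for n
      by (intro AE_I2) (simp add: indicator_def)
  qed (use A in auto)
  then show ?thesis using A by simp
qed

lemma eventually_real_gt: "\<forall>\<^sub>F n in sequentially. c < real n"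
  using filterlim_real_sequentially unfolding filterlim_at_top_dense by blast

lemma eventually_grid_exceeds:
  fixes f :: "real \<Rightarrow> real"
  assumes f: "continuous_on {0..T} f" and s: "s \<in> {0..T}" "c < f s" and T: "0 < T"
  shows "\<forall>\<^sub>F N in sequentially. \<exists>j\<le>N. c < f (real j * T / real N)"
proof -
  obtain d where d: "d > 0" "\<And>x. x \<in> {0..T} \<Longrightarrow> dist x s < d \<Longrightarrow> dist (f x) (f s) < f s - c"
    using f s unfolding continuous_on_iff by (metis diff_gt_0_iff_gt)
  have "\<forall>\<^sub>F N in sequentially. T / d < real N"
    by (rule eventually_real_gt)
  then show ?thesis
  proof eventually_elim
    case (elim N)
    have N: "0 < real N" using elim d(1) T by (meson divide_pos_pos less_trans)
    \<comment> \<open>The grid point just left of \<open>s\<close>, at distance less than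
      \<open>T / real N\<close>.\<close>
    define j where "j = nat \<lfloor>s * real N / T\<rfloor>"
    have j0: "0 \<le> s * real N / T" using s T by simp
    have j1: "real j \<le> s * real N / T" and j2: "s * real N / T < real j + 1"
      using j0 unfolding j_def by linarith+
    have "s * real N / T \<le> real N" using s T N by (simp add: field_simps)
    then have "j \<le> N" using j1 by linarith
    have le: "real j * T / real N \<le> s" using j1 T N by (simp add: field_simps)
    have "s < (real j + 1) * T / real N" using j2 T N by (simp add: field_simps)
    also have "\<dots> = real j * T / real N + T / real N"
      by (simp add: algebra_simps add_divide_distrib)
    also have "T / real N < d" using elim d(1) N by (simp add: field_simps)
    finally have "dist (real j * T / real N) s < d" using le by (simp add: dist_real_def)
    moreover have "real j * T / real N \<in> {0..T}" using le s T by auto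
    ultimately have "dist (f (real j * T / real N)) (f s) < f s - c" using d(2) by blast
    then show ?case using \<open>j \<le> N\<close> by (intro exI[of _ j]) (auto simp: dist_real_def)
  qed
qed

text \<open>The case \<open>N = 0\<close> is included: division by zero puts the point at 0. This
  allows unions over all \<open>N\<close> without a side condition.\<close>

lemma grid_time_in:
  assumes "j \<le> N" "0 \<le> T" shows "real j * T / real N \<in> {0..T}"
  using assms by (cases "N = 0") (auto simp: field_simps intro!: mult_left_mono)

text \<open>By continuity, exceeding \<open>c\<close> somewhere is the same as exceeding it at a
  point of some uniform grid, and there are only countably many such points.\<close>

lemma exceed_event_measurable:
  fixes V :: "real \<Rightarrow> 'a \<Rightarrow> real"
  assumes V: "\<And>s. 0 \<le> s \<Longrightarrow> V s \<in> borel_measurable M"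
    and cont: "\<And>\<omega>. \<omega> \<in> space M \<Longrightarrow> continuous_on {0..T} (\<lambda>s. V s \<omega>)" and T: "0 < T"
  shows "{\<omega> \<in> space M. \<exists>s\<in>{0..T}. c < V s \<omega>} \<in> sets M"
proof -
  have "{\<omega> \<in> space M. \<exists>s\<in>{0..T}. c < V s \<omega>}
      = (\<Union>N. \<Union>j\<in>{..N}. {\<omega> \<in> space M. c < V (real j * T / real N) \<omega>})" (is "?L = ?R")
  proof (intro set_eqI iffI)
    fix \<omega> assume "\<omega> \<in> ?L"
    then obtain s where "\<omega> \<in> space M" "s \<in> {0..T}" "c < V s \<omega>" by auto
    then show "\<omega> \<in> ?R"
      using eventually_grid_exceeds[OF cont _ _ T, of \<omega> s c] by (auto dest!: eventually_happens)
  next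
    fix \<omega> assume "\<omega> \<in> ?R"
    then show "\<omega> \<in> ?L" using grid_time_in T less_imp_le by blast
  qed
  also have "\<dots> \<in> sets M"
  proof (intro sets.countable_UN sets.finite_UN finite_atMost subsetI)
    have "{\<omega> \<in> space M. c < V (real j * T / real N) \<omega>} \<in> sets M" for j N
    proof -
      have [measurable]: "V (real j * T / real N) \<in> borel_measurable M" using T by (intro V) simp
      show ?thesis by measurable
    qed
    then show "\<And>x. x \<in> range (\<lambda>N. \<Union>j\<in>{..N}. {\<omega> \<in> space M. c < V (real j * T / real N) \<omega>}) \<Longrightarrow> x \<in> sets M"
      by (auto intro!: sets.finite_UN)
  qed
  finally show ?thesis .
qed

lemma integral_grid_sum:
  fixes f :: "real \<Rightarrow> 'b::banach"
  assumes f: "continuous_on {0..} f" and t: "0 \<le> d"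
  shows "integral {0..real m * d} f = (\<Sum>k<m. integral {real k * d..real (Suc k) * d} f)"
proof (induction m)
  case (Suc m)
  have "f integrable_on {0..real (Suc m) * d}"
    using f by (intro integrable_continuous_real continuous_on_subset[OF f]) auto
  then have "integral {0..real (Suc m) * d} f
      = integral {0..real m * d} f + integral {real m * d..real (Suc m) * d} f"
    using t by (intro Henstock_Kurzweil_Integration.integral_combine[symmetric])
      (auto intro!: mult_right_mono)
  then show ?case using Suc by simp
qed simp

lemma left_riemann_sums_tendsto:
  fixes f :: "real \<Rightarrow> 'b::banach"
  assumes f: "continuous_on {0..} f" and t: "0 < t"
  shows "(\<lambda>n. \<Sum>k<n. (t / real n) *\<^sub>R f (real k * t / real n)) \<longlonglongrightarrow> integral {0..t} f"
proof (rule tendstoI)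
  fix e :: real assume e: "e > 0"
  have "uniformly_continuous_on {0..t} f"
    using f by (intro compact_uniformly_continuous continuous_on_subset[OF f]) auto
  then obtain d where d: "d > 0" "\<And>x y. x \<in> {0..t} \<Longrightarrow> y \<in> {0..t} \<Longrightarrow> dist x y < d \<Longrightarrow> dist (f x) (f y) < e / (2 * t)"
    using e t unfolding uniformly_continuous_on_def by (metis divide_pos_pos mult_pos_pos zero_less_numeral)
  have "\<forall>\<^sub>F n in sequentially. t / d < real n"
    by (rule eventually_real_gt)
  then show "\<forall>\<^sub>F n in sequentially. dist (\<Sum>k<n. (t / real n) *\<^sub>R f (real k * t / real n)) (integral {0..t} f) < e"
  proof eventually_elim
    case (elim n)
    have n: "0 < real n" using elim d(1) t by (meson divide_pos_pos less_trans)
    define h where "h = t / real n"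
    have h: "0 < h" "h < d" using elim d(1) n t by (auto simp: h_def field_simps)
    have nh: "real n * h = t" using n by (simp add: h_def)
    have tk: "real k * t / real n = real k * h" for k by (simp add: h_def)
    \<comment> \<open>Uniform continuity on each cell. With \<open>e / (2 * t)\<close> the cells add
      up to \<open>e / 2\<close>, which leaves the strict inequality.\<close>
    have bound: "norm (h *\<^sub>R f (real k * h) - integral {real k * h..real (Suc k) * h} f) \<le> e / (2 * t) * h"
      if "k < n" for k
    proof -
      have le: "real k * h \<le> real (Suc k) * h" using h by simp
      have "real (Suc k) * h \<le> real n * h" using that h by (intro mult_right_mono) auto
      then have sub: "{real k * h..real (Suc k) * h} \<subseteq> {0..t}" using nh h by auto
      have int: "f integrable_on {real k * h..real (Suc k) * h}"
        using sub by (intro integrable_continuous_real continuous_on_subset[OF f]) auto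
      have "h *\<^sub>R f (real k * h) = integral {real k * h..real (Suc k) * h} (\<lambda>_. f (real k * h))"
        using le by (simp add: algebra_simps)
      then have "h *\<^sub>R f (real k * h) - integral {real k * h..real (Suc k) * h} f
          = integral {real k * h..real (Suc k) * h} (\<lambda>s. f (real k * h) - f s)"
        using int by (simp add: Henstock_Kurzweil_Integration.integral_diff integrable_const_ivl)
      also have "norm \<dots> \<le> e / (2 * t) * (real (Suc k) * h - real k * h)"
      proof (rule integral_bound[OF le])
        show "continuous_on {real k * h..real (Suc k) * h} (\<lambda>s. f (real k * h) - f s)"
          using sub by (intro continuous_intros continuous_on_subset[OF f]) auto
        fix s assume s: "s \<in> {real k * h..real (Suc k) * h}"
        have "dist (real k * h) s < d" using s h by (auto simp: dist_real_def algebra_simps)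
        moreover have "real k * h \<in> {0..t}" "s \<in> {0..t}" using sub s le by auto
        ultimately have "dist (f (real k * h)) (f s) < e / (2 * t)" by (intro d(2))
        then show "norm (f (real k * h) - f s) \<le> e / (2 * t)" by (simp add: dist_norm)
      qed
      finally show ?thesis by (simp add: algebra_simps)
    qed
    have "dist (\<Sum>k<n. (t / real n) *\<^sub>R f (real k * t / real n)) (integral {0..t} f)
        = norm (\<Sum>k<n. h *\<^sub>R f (real k * h) - integral {real k * h..real (Suc k) * h} f)"
      using integral_grid_sum[OF f, of h n] h nh
      unfolding tk by (simp add: dist_norm sum_subtractf h_def)
    also have "\<dots> \<le> (\<Sum>k<n. e / (2 * t) * h)" using bound by (intro sum_norm_le) auto
    also have "\<dots> = e / (2 * t) * (real n * h)" by simp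
    also have "\<dots> < e" using nh t e by simp
    finally show ?case .
  qed
qed

text \<open>A fine point and the start of its block are less than one coarse step
  \<open>T / real N\<close> apart. The threshold on \<open>N\<close> therefore does not depend on
  the refinement \<open>n\<close>, which may later be chosen arbitrarily fast in
  \<open>N\<close>.\<close>

lemma eventually_block_oscillation_small:
  fixes f :: "real \<Rightarrow> 'b::metric_space" and n :: "nat \<Rightarrow> nat"
  assumes f: "continuous_on {0..T} f" and T: "0 < T" and \<kappa>: "0 < \<kappa>"
    and n: "\<And>N. 0 < n N"
  shows "\<forall>\<^sub>F N in sequentially. \<forall>k<N * n N.
    dist (f (real k * T / real (N * n N))) (f (real (k div n N * n N) * T / real (N * n N))) \<le> \<kappa>"
proof -
  have "uniformly_continuous_on {0..T} f"
    using f by (intro compact_uniformly_continuous) auto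
  then obtain d where d: "d > 0" "\<And>x y. x \<in> {0..T} \<Longrightarrow> y \<in> {0..T} \<Longrightarrow> dist x y < d \<Longrightarrow> dist (f x) (f y) < \<kappa>"
    using \<kappa> unfolding uniformly_continuous_on_def by metis
  have "\<forall>\<^sub>F N in sequentially. T / d < real N"
    by (rule eventually_real_gt)
  then show ?thesis
  proof eventually_elim
    case (elim N)
    have N: "0 < real N" using elim d(1) T by (meson divide_pos_pos less_trans)
    show ?case
    proof (intro allI impI)
      fix k assume k: "k < N * n N"
      let ?p = "k div n N * n N"
      have le: "?p \<le> k" by simp
      have "k - ?p = k mod n N" by (metis minus_div_mult_eq_mod)
      then have lt: "real k - real ?p < real (n N)"
        using le n[of N] mod_less_divisor[of "n N" k] by linarith
      have "real k * T / real (N * n N) - real ?p * T / real (N * n N)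
          = (real k - real ?p) * (T / real (N * n N))" by (simp add: algebra_simps diff_divide_distrib)
      also have "\<dots> < real (n N) * (T / real (N * n N))"
        using lt T N n[of N] by (intro mult_strict_right_mono) auto
      also have "\<dots> = T / real N" using n[of N] by simp
      also have "\<dots> < d" using elim d(1) N by (simp add: field_simps)
      finally have close: "real k * T / real (N * n N) - real ?p * T / real (N * n N) < d" .
      have mono: "real ?p * T / real (N * n N) \<le> real k * T / real (N * n N)"
        using le T by (intro divide_right_mono mult_right_mono) (auto simp del: of_nat_mult)
      from close have "dist (real k * T / real (N * n N)) (real ?p * T / real (N * n N)) < d"
        unfolding dist_real_def using mono by linarith
      moreover have "real k * T / real (N * n N) \<in> {0..T}" "real ?p * T / real (N * n N) \<in> {0..T}"
        using k le T by (intro grid_time_in; linarith)+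
      ultimately show "dist (f (real k * T / real (N * n N))) (f (real ?p * T / real (N * n N))) \<le> \<kappa>"
        using d(2) less_imp_le by blast
    qed
  qed
qed

section \<open>Brownian increments and Euler sums\<close>

text \<open>Each coordinate of an increment over a step of length \<open>d\<close> is normal with
  variance \<open>d\<close>, so the second moments of the coordinates add up to
  \<open>real CARD('m) * d\<close>.\<close>

lemma brownian_increments_adapted_noise:
  fixes W :: "real \<Rightarrow> 'a \<Rightarrow> real^'m"
  assumes BM: "brownian_motion M F W" and \<tau>: "\<And>k. 0 \<le> \<tau> k" "\<And>k. \<tau> (Suc k) = \<tau> k + d" and d: "0 < d"
  shows "adapted_noise M (\<lambda>k. F (\<tau> k)) (\<lambda>k \<omega>. W (\<tau> (Suc k)) \<omega> - W (\<tau> k) \<omega>) (real CARD('m) * d)"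
proof -
  interpret prob_space M using BM by (simp add: brownian_motion_def)
  have filt: "\<And>t. subalgebra M (F t)" "\<And>s t. s \<le> t \<Longrightarrow> sets (F s) \<subseteq> sets (F t)"
    using BM by (auto simp: brownian_motion_def is_filtration_def)
  have W_meas: "\<And>t. 0 \<le> t \<Longrightarrow> W t \<in> borel_measurable (F t)"
    using BM by (auto simp: brownian_motion_def)
  have lt: "\<tau> k < \<tau> (Suc k)" for k using \<tau>(2) d by simp
  have \<tau>_mono: "\<tau> k \<le> \<tau> l" if "k \<le> l" for k l
    by (rule lift_Suc_mono_le[of \<tau>, OF less_imp_le[OF lt] that])
  let ?\<xi> = "\<lambda>k \<omega>. W (\<tau> (Suc k)) \<omega> - W (\<tau> k) \<omega>"
  have \<xi>_meas: "?\<xi> k \<in> borel_measurable (F (\<tau> (Suc k)))" for k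
  proof (rule borel_measurable_diff)
    show "W (\<tau> (Suc k)) \<in> borel_measurable (F (\<tau> (Suc k)))" by (rule W_meas[OF \<tau>(1)])
    have "subalgebra (F (\<tau> (Suc k))) (F (\<tau> k))"
      using filt(1)[of "\<tau> k"] filt(1)[of "\<tau> (Suc k)"] filt(2)[of "\<tau> k" "\<tau> (Suc k)"] lt[of k]
      by (simp add: subalgebra_def)
    then show "W (\<tau> k) \<in> borel_measurable (F (\<tau> (Suc k)))"
      using W_meas[OF \<tau>(1)] by (rule measurable_from_subalg)
  qed
  have dist: "distributed M lborel (\<lambda>\<omega>. ?\<xi> k \<omega> $ i) (normal_density 0 (sqrt d))" for k i
  proof -
    have "\<forall>u::real^'m. u \<noteq> 0 \<longrightarrow> distributed M lborel (\<lambda>\<omega>. u \<bullet> ?\<xi> k \<omega>)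
        (normal_density 0 (sqrt (\<tau> (Suc k) - \<tau> k) * norm u))"
      using BM \<tau>(1)[of k] lt[of k] unfolding brownian_motion_def by blast
    \<comment> \<open>A coordinate is the projection to a unit vector, so it is among the
      projections whose law is prescribed.\<close>
    from this[rule_format, of "axis i 1"] show ?thesis
      using \<tau>(2)[of k] by (simp add: inner_axis' axis_eq_0_iff)
  qed
  have sd: "0 < sqrt d" using d by simp
  have mean: "expectation (\<lambda>\<omega>. ?\<xi> k \<omega> $ i) = 0" for k i
    by (rule normal_distributed_expectation[OF sd dist])
  have sq_int: "integrable M (\<lambda>\<omega>. (?\<xi> k \<omega> $ i)\<^sup>2)" for k i
    using distributed_integrable[OF dist[of k i], of "\<lambda>x. x\<^sup>2"]
      integrable_normal_moment[OF sd, of 0 2] by simp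
  have sq: "expectation (\<lambda>\<omega>. (?\<xi> k \<omega> $ i)\<^sup>2) = d" for k i
    using normal_distributed_variance[OF sd dist[of k i]] mean[of k i] d by simp
  have norm_sq: "(norm z)\<^sup>2 = (\<Sum>i\<in>UNIV. (z $ i)\<^sup>2)" for z :: "real^'m"
    unfolding power2_norm_eq_inner inner_vec_def by (simp add: power2_eq_square)
  show ?thesis
  proof (unfold_locales)
    show "indep_set (sets (F (\<tau> k))) {?\<xi> k -` A \<inter> space M |A. A \<in> sets borel}" for k
      using BM \<tau>(1)[of k] lt[of k] unfolding brownian_motion_def by blast
    show "integrable M (\<lambda>\<omega>. (norm (?\<xi> k \<omega>))\<^sup>2)" for k
      unfolding norm_sq using sq_int by (intro Bochner_Integration.integrable_sum)
    show "expectation (\<lambda>\<omega>. (norm (?\<xi> k \<omega>))\<^sup>2) \<le> real CARD('m) * d" for k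
      unfolding norm_sq using sq_int[of k] sq[of k] by (subst Bochner_Integration.integral_sum) auto
  qed (use filt \<tau>_mono \<xi>_meas mean in auto)
qed

text \<open>Not a recursive scheme: the coefficients are evaluated along the given process
  \<open>X\<close>. The noise part is thus literally the Riemann sum in the definition of the Ito
  integral.\<close>

definition sde_euler_sum ::
  "(real \<Rightarrow> 'a \<Rightarrow> real^'m) \<Rightarrow> (real^'d \<Rightarrow> real^'m^'d) \<Rightarrow> (real^'d \<Rightarrow> real^'d) \<Rightarrow> real^'d \<Rightarrow>
    (real \<Rightarrow> 'a \<Rightarrow> real^'d) \<Rightarrow> real \<Rightarrow> nat \<Rightarrow> 'a \<Rightarrow> real^'d" where
  "sde_euler_sum W \<sigma> b x X t n \<omega> = x + ito_riemann_sum (\<lambda>s \<omega>. \<sigma> (X s \<omega>)) W t n \<omega>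
     + (\<Sum>k<n. (t / real n) *\<^sub>R b (X (real k * t / real n) \<omega>))"

text \<open>The noise part converges in probability to \<open>X t - x\<close> minus the drift
  integral, by the definition of a solution; the drift part converges on every path to that
  integral. The two limits recombine to \<open>X t\<close>.\<close>

lemma sde_euler_sum_converges:
  fixes W :: "real \<Rightarrow> 'a \<Rightarrow> real^'m" and X :: "real \<Rightarrow> 'a \<Rightarrow> real^'d"
  assumes BM: "brownian_motion M F W" and sol: "sde_solution M F W \<sigma> b x X"
    and cont: "continuous_on UNIV \<sigma>" "continuous_on UNIV b" and t: "0 < t"
  shows "sde_euler_sum W \<sigma> b x X t n \<in> borel_measurable M"
    and "conv_in_prob M (sde_euler_sum W \<sigma> b x X t) (X t)"
proof -
  interpret prob_space M using BM by (simp add: brownian_motion_def)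
  have sub: "\<And>s. subalgebra M (F s)" using BM by (auto simp: brownian_motion_def is_filtration_def)
  have W_meas: "W s \<in> borel_measurable M" if "0 \<le> s" for s
    using BM that by (auto simp: brownian_motion_def intro: measurable_from_subalg[OF sub])
  have X_meas: "X s \<in> borel_measurable M" if "0 \<le> s" for s
    using sol that by (auto simp: sde_solution_def intro: measurable_from_subalg[OF sub])
  have \<sigma>X_meas: "(\<lambda>\<omega>. \<sigma> (X s \<omega>)) \<in> borel_measurable M" if "0 \<le> s" for s
    using measurable_compose[OF X_meas[OF that] borel_measurable_continuous_onI[OF cont(1)]] .
  have bX_meas: "(\<lambda>\<omega>. b (X s \<omega>)) \<in> borel_measurable M" if "0 \<le> s" for s
    using measurable_compose[OF X_meas[OF that] borel_measurable_continuous_onI[OF cont(2)]] .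
  let ?S = "ito_riemann_sum (\<lambda>s \<omega>. \<sigma> (X s \<omega>)) W t"
  let ?R = "\<lambda>n \<omega>. \<Sum>k<n. (t / real n) *\<^sub>R b (X (real k * t / real n) \<omega>)"
  let ?B = "\<lambda>\<omega>. integral {0..t} (\<lambda>s. b (X s \<omega>))"
  have S_meas[measurable]: "?S n \<in> borel_measurable M" for n
    unfolding ito_riemann_sum_def
    using t by (intro borel_measurable_sum borel_measurable_matrix_vector_mult borel_measurable_diff
        \<sigma>X_meas W_meas) auto
  have R_meas[measurable]: "?R n \<in> borel_measurable M" for n
    using t by (intro borel_measurable_sum borel_measurable_scaleR borel_measurable_const bX_meas) auto
  have R_lim: "(\<lambda>n. ?R n \<omega>) \<longlonglongrightarrow> ?B \<omega>" if "\<omega> \<in> space M" for \<omega>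
  proof (rule left_riemann_sums_tendsto[OF _ t])
    have "continuous_on {0..} (\<lambda>s. X s \<omega>)" using sol that by (simp add: sde_solution_def)
    then show "continuous_on {0..} (\<lambda>s. b (X s \<omega>))"
      by (rule continuous_on_compose2[OF cont(2)]) auto
  qed
  \<comment> \<open>Measurability of the pathwise drift integral is inherited from its Riemann
    sums.\<close>
  have B_meas[measurable]: "?B \<in> borel_measurable M"
    by (rule borel_measurable_LIMSEQ_metric[OF R_meas R_lim])
  have [measurable]: "X t \<in> borel_measurable M" using t by (intro X_meas) simp
  show E_meas: "sde_euler_sum W \<sigma> b x X t n \<in> borel_measurable M" for n
    unfolding sde_euler_sum_def[abs_def] by measurable
  let ?I = "\<lambda>\<omega>. X t \<omega> - x - ?B \<omega>"
  have ito: "conv_in_prob M ?S ?I"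
    using sol t by (simp add: sde_solution_def is_ito_integral_def)
  show "conv_in_prob M (sde_euler_sum W \<sigma> b x X t) (X t)"
    unfolding conv_in_prob_def
  proof (intro allI impI)
    fix e :: real assume e: "e > 0"
    let ?A1 = "\<lambda>n. {\<omega> \<in> space M. dist (?S n \<omega>) (?I \<omega>) > e / 2}"
    let ?A2 = "\<lambda>n. {\<omega> \<in> space M. dist (?R n \<omega>) (?B \<omega>) > e / 2}"
    have m1: "?A1 n \<in> sets M" and m2: "?A2 n \<in> sets M" for n by measurable
    have l1: "(\<lambda>n. prob (?A1 n)) \<longlonglongrightarrow> 0"
      using ito e unfolding conv_in_prob_def by (meson half_gt_zero)
    have l2: "(\<lambda>n. prob (?A2 n)) \<longlonglongrightarrow> 0"
    proof (rule prob_tendsto_zero[OF m2])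
      fix \<omega> assume "\<omega> \<in> space M"
      from tendstoD[OF R_lim[OF this], of "e / 2"] e
      have "\<forall>\<^sub>F n in sequentially. dist (?R n \<omega>) (?B \<omega>) < e / 2" by simp
      then show "\<forall>\<^sub>F n in sequentially. \<omega> \<notin> ?A2 n" by eventually_elim auto
    qed
    have le: "prob {\<omega> \<in> space M. dist (sde_euler_sum W \<sigma> b x X t n \<omega>) (X t \<omega>) > e}
        \<le> prob (?A1 n) + prob (?A2 n)" for n
    proof -
      have "{\<omega> \<in> space M. dist (sde_euler_sum W \<sigma> b x X t n \<omega>) (X t \<omega>) > e} \<subseteq> ?A1 n \<union> ?A2 n"
      proof
        fix \<omega> assume \<omega>: "\<omega> \<in> {\<omega> \<in> space M. dist (sde_euler_sum W \<sigma> b x X t n \<omega>) (X t \<omega>) > e}"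
        have "sde_euler_sum W \<sigma> b x X t n \<omega> - X t \<omega> = (?S n \<omega> - ?I \<omega>) + (?R n \<omega> - ?B \<omega>)"
          by (simp add: sde_euler_sum_def)
        then have "dist (sde_euler_sum W \<sigma> b x X t n \<omega>) (X t \<omega>) \<le> dist (?S n \<omega>) (?I \<omega>) + dist (?R n \<omega>) (?B \<omega>)"
          unfolding dist_norm by (metis norm_triangle_ineq)
        then show "\<omega> \<in> ?A1 n \<union> ?A2 n" using \<omega> by auto
      qed
      then have "prob {\<omega> \<in> space M. dist (sde_euler_sum W \<sigma> b x X t n \<omega>) (X t \<omega>) > e} \<le> prob (?A1 n \<union> ?A2 n)"
        using m1 m2 by (intro finite_measure_mono) auto
      also have "\<dots> \<le> prob (?A1 n) + prob (?A2 n)" by (rule measure_Un_le[OF m1 m2])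
      finally show ?thesis .
    qed
    have l12: "(\<lambda>n. prob (?A1 n) + prob (?A2 n)) \<longlonglongrightarrow> 0" using tendsto_add[OF l1 l2] by simp
    show "(\<lambda>n. prob {\<omega> \<in> space M. dist (sde_euler_sum W \<sigma> b x X t n \<omega>) (X t \<omega>) > e}) \<longlonglongrightarrow> 0"
      by (rule tendsto_sandwich[OF _ _ tendsto_const l12]) (use le in auto)
  qed
qed

section \<open>The concave Lyapunov function\<close>

text \<open>The derivative of \<open>s * r s\<close> is \<open>r s * (1 + s * r' s / r s)\<close>,
  nonnegative near 0 by the ratio condition, so the product increases there. It tends to 0 at 0,
  since a positive lower bound would make the integral of its reciprocal finite. Freezing it beyond
  \<open>a\<close> and extending by 0 to the left gives a global modulus.\<close>

lemma osgood_modulus: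
  fixes r r' :: "real \<Rightarrow> real"
  assumes r_pos: "\<forall>x. 0 < x \<and> x < 1 \<longrightarrow> r x > 0"
    and r_deriv: "\<forall>x. 0 < x \<and> x < 1 \<longrightarrow> (r has_real_derivative r' x) (at x)"
    and r_ratio: "((\<lambda>x. x * r' x / r x) \<longlongrightarrow> 0) (at_right 0)"
    and r_int: "\<forall>a. 0 < a \<and> a < 1 \<longrightarrow>
        (\<integral>\<^sup>+ s. ennreal (indicator {0<..a} s / (s * r s)) \<partial>lborel) = \<infinity>"
  obtains a \<mu> where "0 < a" "a < 1" "continuous_on UNIV \<mu>" "mono \<mu>" "\<And>s. 0 \<le> \<mu> s" "\<mu> 0 = 0"
    "\<And>s. 0 < s \<Longrightarrow> s \<le> a \<Longrightarrow> \<mu> s = s * r s"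
proof -
  have "\<forall>\<^sub>F x in at_right 0. - 1 < x * r' x / r x"
    using order_tendstoD(1)[OF r_ratio, of "-1"] by simp
  then obtain a0 where a0: "a0 > 0" "\<And>x. 0 < x \<Longrightarrow> x < a0 \<Longrightarrow> - 1 < x * r' x / r x"
    unfolding eventually_at_right_field by auto
  \<comment> \<open>Halving keeps the closed range up to \<open>a\<close> strictly inside both
    domains, that of the ratio bound and that of \<open>r\<close>.\<close>
  define a where "a = min (a0 / 2) (1 / 2)"
  have a: "0 < a" "a < 1" "a < a0" using a0(1) by (auto simp: a_def)
  define m where "m x = x * r x" for x
  have m_deriv: "(m has_real_derivative r x + x * r' x) (at x)" if "0 < x" "x < 1" for x
    unfolding m_def using r_deriv that by (auto intro!: derivative_eq_intros)
  have m_deriv_nonneg: "0 \<le> r x + x * r' x" if "0 < x" "x \<le> a" for x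
    using a0(2)[of x] r_pos[rule_format, of x] that a by (simp add: field_simps)
  have m_mono: "m x \<le> m y" if "0 < x" "x \<le> y" "y \<le> a" for x y
  proof (rule DERIV_nonneg_imp_nondecreasing[OF that(2)])
    fix z assume "x \<le> z" "z \<le> y"
    then have "0 < z" "z \<le> a" "z < 1" using that a by auto
    then show "\<exists>D. (m has_real_derivative D) (at z) \<and> 0 \<le> D"
      using m_deriv m_deriv_nonneg by blast
  qed
  have m_pos: "0 < m x" if "0 < x" "x < 1" for x using r_pos that by (simp add: m_def)
  \<comment> \<open>This is where divergence of the integral forces the modulus to vanish at 0. By
    monotonicity a single small value is enough.\<close>
  have m_small: "\<exists>x. 0 < x \<and> x \<le> a \<and> m x < e" if "e > 0" for e
  proof (rule ccontr)
    assume "\<not> ?thesis"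
    then have ge: "e \<le> m x" if "0 < x" "x \<le> a" for x using that by force
    have "(\<integral>\<^sup>+ s. ennreal (indicator {0<..a} s / (s * r s)) \<partial>lborel)
        \<le> (\<integral>\<^sup>+ s. ennreal (1 / e) * indicator {0<..a} s \<partial>lborel)"
    proof (rule nn_integral_mono)
      fix s :: real
      have "0 < s \<Longrightarrow> s \<le> a \<Longrightarrow> 1 / (s * r s) \<le> 1 / e"
        using ge[of s] \<open>e > 0\<close> unfolding m_def by (intro divide_left_mono) auto
      then show "ennreal (indicator {0<..a} s / (s * r s)) \<le> ennreal (1 / e) * indicator {0<..a} s"
        by (auto simp: indicator_def intro!: ennreal_leI)
    qed
    also have "\<dots> = ennreal (1 / e) * ennreal a"
      using a by (simp add: nn_integral_cmult_indicator)
    also have "\<dots> < \<infinity>" by (simp add: ennreal_mult_less_top)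
    finally show False using r_int a by simp
  qed
  define \<mu> where "\<mu> x = (if x \<le> 0 then 0 else m (min x a))" for x
  have \<mu>_nonneg: "0 \<le> \<mu> y" for y
  proof (cases "y \<le> 0")
    case False
    then have "0 < m (min y a)" using a by (intro m_pos) auto
    then show ?thesis using False by (simp add: \<mu>_def)
  qed (simp add: \<mu>_def)
  have \<mu>_mono: "mono \<mu>"
  proof (rule monoI)
    fix x y :: real assume "x \<le> y"
    then show "\<mu> x \<le> \<mu> y"
      using m_mono[of "min x a" "min y a"] m_pos[of "min y a"] a
      by (auto simp: \<mu>_def min_def)
  qed
  have \<mu>_cont: "isCont \<mu> x" for x
  proof -
    consider "x < 0" | "x = 0" | "0 < x" by linarith
    then show ?thesis
    proof cases
      case 1
      have "\<forall>\<^sub>F y in nhds x. \<mu> y = 0"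
        using eventually_nhds_in_open[of "{..<0}" x] 1 by (auto simp: \<mu>_def elim: eventually_mono)
      then show ?thesis by (simp add: isCont_cong)
    next
      case 2
      have "(\<mu> \<longlongrightarrow> 0) (at 0)"
      proof (rule tendstoI)
        fix e :: real assume "e > 0"
        then obtain x where x: "0 < x" "x \<le> a" "m x < e" using m_small by blast
        have "\<forall>\<^sub>F y in nhds 0. y \<in> {..<x}"
          using eventually_nhds_in_open[of "{..<x}" 0] x by simp
        then have "\<forall>\<^sub>F y in nhds 0. dist (\<mu> y) 0 < e"
        proof eventually_elim
          case (elim y)
          note \<mu>_nonneg[of y]
          moreover have "\<mu> y \<le> \<mu> x" using elim by (intro monoD[OF \<mu>_mono]) simp
          moreover have "\<mu> x = m x" using x by (simp add: \<mu>_def min_def)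
          ultimately show ?case using x by simp
        qed
        then show "\<forall>\<^sub>F y in at 0. dist (\<mu> y) 0 < e" by (auto simp: eventually_at_filter elim: eventually_mono)
      qed
      then show ?thesis using 2 by (simp add: isCont_def \<mu>_def)
    next
      case 3
      have "isCont m (min x a)"
        using 3 a by (simp add: DERIV_isCont[OF m_deriv])
      moreover have "isCont (\<lambda>y. min y a) x" by (intro continuous_intros)
      ultimately have "isCont (\<lambda>y. m (min y a)) x"
        using isCont_o2[of x "\<lambda>y. min y a" m] by simp
      moreover have "\<forall>\<^sub>F y in nhds x. \<mu> y = m (min y a)"
        using eventually_nhds_in_open[of "{0<..}" x] 3 by (auto simp: \<mu>_def elim: eventually_mono)
      ultimately show ?thesis by (simp add: isCont_cong)
    qed
  qed
  show thesis
  proof (rule that[of a \<mu>])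
    show "continuous_on UNIV \<mu>" using \<mu>_cont by (simp add: continuous_at_imp_continuous_on)
  qed (use a \<mu>_mono \<mu>_nonneg in \<open>auto simp: \<mu>_def m_def min_def\<close>)
qed

text \<open>For \<open>x < 0\<close> the value is \<open>0\<close>, which keeps the function monotone on the whole line.\<close>

definition osgood_lyapunov :: "(real \<Rightarrow> real) \<Rightarrow> real \<Rightarrow> real \<Rightarrow> real" where
  "osgood_lyapunov \<mu> \<delta> x = integral {0..x} (\<lambda>s. 1 / (\<mu> s + \<delta>))"

context
  fixes \<mu> :: "real \<Rightarrow> real"
  assumes \<mu>_cont: "continuous_on UNIV \<mu>" and \<mu>_mono: "mono \<mu>" and \<mu>_nonneg: "\<And>x. 0 \<le> \<mu> x"
begin

lemma osgood_lyapunov_integrable: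
  "\<delta> > 0 \<Longrightarrow> (\<lambda>s. 1 / (\<mu> s + \<delta>)) integrable_on {x..y}"
  using \<mu>_nonneg
  by (intro integrable_continuous_real continuous_intros continuous_on_subset[OF \<mu>_cont])
    (auto simp: add_nonneg_eq_0_iff)

lemma osgood_lyapunov_diff:
  assumes "\<delta> > 0" "0 \<le> x" "x \<le> y"
  shows "osgood_lyapunov \<mu> \<delta> y = osgood_lyapunov \<mu> \<delta> x + integral {x..y} (\<lambda>s. 1 / (\<mu> s + \<delta>))"
  unfolding osgood_lyapunov_def
  using Henstock_Kurzweil_Integration.integral_combine[OF assms(2,3)
      osgood_lyapunov_integrable[OF assms(1), of 0 y]] by simp

lemma mono_osgood_lyapunov:
  assumes "\<delta> > 0" shows "mono (osgood_lyapunov \<mu> \<delta>)"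
proof (rule monoI)
  fix x y :: real assume "x \<le> y"
  have nn: "0 \<le> integral {u..v} (\<lambda>s. 1 / (\<mu> s + \<delta>))" for u v
    using \<mu>_nonneg assms by (intro integral_nonneg osgood_lyapunov_integrable) (auto simp: add_nonneg_nonneg)
  show "osgood_lyapunov \<mu> \<delta> x \<le> osgood_lyapunov \<mu> \<delta> y"
  proof (cases "0 \<le> x")
    case True
    then show ?thesis using osgood_lyapunov_diff[OF assms True \<open>x \<le> y\<close>] nn[of x y] by simp
  next
    case False
    then show ?thesis using nn[of 0 y] by (simp add: osgood_lyapunov_def)
  qed
qed

text \<open>The derivative \<open>1 / (\<mu> s + \<delta>)\<close> is non-increasing because
  \<open>\<mu>\<close> is monotone; on either side of \<open>x\<close> the integrand is compared
  with its value at \<open>x\<close>.\<close>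

lemma osgood_lyapunov_concave:
  assumes "\<delta> > 0" "0 \<le> x" "0 \<le> y"
  shows "osgood_lyapunov \<mu> \<delta> y \<le> osgood_lyapunov \<mu> \<delta> x + 1 / (\<mu> x + \<delta>) * (y - x)"
proof (cases "x \<le> y")
  case True
  have "integral {x..y} (\<lambda>s. 1 / (\<mu> s + \<delta>)) \<le> integral {x..y} (\<lambda>s. 1 / (\<mu> x + \<delta>))"
    using assms \<mu>_nonneg[of x] monoD[OF \<mu>_mono]
    by (intro integral_le osgood_lyapunov_integrable integrable_const_ivl)
      (auto intro!: divide_left_mono mult_pos_pos add_nonneg_pos \<mu>_nonneg)
  then show ?thesis using osgood_lyapunov_diff[OF assms(1,2) True] True by simp
next
  case False
  have "integral {y..x} (\<lambda>s. 1 / (\<mu> x + \<delta>)) \<le> integral {y..x} (\<lambda>s. 1 / (\<mu> s + \<delta>))"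
    using assms \<mu>_nonneg[of x] monoD[OF \<mu>_mono]
    by (intro integral_le osgood_lyapunov_integrable integrable_const_ivl)
      (auto intro!: divide_left_mono mult_pos_pos add_nonneg_pos \<mu>_nonneg)
  then show ?thesis using osgood_lyapunov_diff[OF assms(1,3), of x] False
    by (simp add: diff_divide_distrib)
qed

text \<open>Along \<open>\<delta> = 1 / real (Suc i)\<close> the integrands increase to
  \<open>1 / \<mu> s\<close> on \<open>{0<..c}\<close>. A common bound \<open>B\<close> would, by
  monotone convergence, bound the divergent integral.\<close>

lemma osgood_lyapunov_unbounded:
  assumes c: "0 < c" and inf: "(\<integral>\<^sup>+ s. ennreal (indicator {0<..c} s / \<mu> s) \<partial>lborel) = \<infinity>"
    and pos: "\<And>s. 0 < s \<Longrightarrow> s \<le> c \<Longrightarrow> 0 < \<mu> s"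
  shows "\<exists>\<delta>>0. B < osgood_lyapunov \<mu> \<delta> c"
proof (rule ccontr)
  assume "\<not> ?thesis"
  then have le: "osgood_lyapunov \<mu> \<delta> c \<le> B" if "\<delta> > 0" for \<delta> using that by force
  define f where "f i s = ennreal (indicator {0..c} s * (1 / (\<mu> s + 1 / real (Suc i))))" for i s
  have pos': "0 < \<mu> s + 1 / real (Suc i)" for i s by (intro add_nonneg_pos \<mu>_nonneg) simp
  have f_meas: "f i \<in> borel_measurable lborel" for i
  proof -
    have [measurable]: "\<mu> \<in> borel_measurable borel"
      using \<mu>_cont by (rule borel_measurable_continuous_onI)
    show ?thesis unfolding f_def by measurable
  qed
  have f_inc: "incseq f"
  proof (rule incseq_SucI, rule le_funI)
    fix i s
    have "1 / (\<mu> s + 1 / real (Suc i)) \<le> 1 / (\<mu> s + 1 / real (Suc (Suc i)))"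
    proof (rule divide_left_mono)
      show "\<mu> s + 1 / real (Suc (Suc i)) \<le> \<mu> s + 1 / real (Suc i)" by (simp add: frac_le)
      show "0 < (\<mu> s + 1 / real (Suc i)) * (\<mu> s + 1 / real (Suc (Suc i)))"
        using pos'[of s i] pos'[of s "Suc i"] by (rule mult_pos_pos)
    qed simp
    then show "f i s \<le> f (Suc i) s"
      unfolding f_def by (intro ennreal_leI mult_left_mono) auto
  qed
  have f_int: "(\<integral>\<^sup>+ s. f i s \<partial>lborel) \<le> ennreal B" for i
  proof -
    have "((\<lambda>s. 1 / (\<mu> s + 1 / real (Suc i))) has_integral osgood_lyapunov \<mu> (1 / real (Suc i)) c) {0..c}"
      unfolding osgood_lyapunov_def
      using osgood_lyapunov_integrable[of "1 / real (Suc i)" 0 c] by (simp add: has_integral_integral)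
    then have "(\<integral>\<^sup>+ s. f i s \<partial>lborel) = ennreal (osgood_lyapunov \<mu> (1 / real (Suc i)) c)"
      unfolding f_def using pos'
      by (intro nn_integral_has_integral_lebesgue) (auto intro: less_imp_le)
    then show ?thesis using le[of "1 / real (Suc i)"] by (simp add: ennreal_leI)
  qed
  have "(\<integral>\<^sup>+ s. ennreal (indicator {0<..c} s / \<mu> s) \<partial>lborel) \<le> (\<integral>\<^sup>+ s. (SUP i. f i s) \<partial>lborel)"
  proof (rule nn_integral_mono)
    fix s :: real
    show "ennreal (indicator {0<..c} s / \<mu> s) \<le> (SUP i. f i s)"
    proof (cases "s \<in> {0<..c}")
      case True
      then have "0 < \<mu> s" using pos by simp
      have "(\<lambda>i. 1 / (\<mu> s + 1 / real (Suc i))) \<longlonglongrightarrow> 1 / (\<mu> s + 0)"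
        using \<open>0 < \<mu> s\<close> by (intro tendsto_intros LIMSEQ_Suc[OF lim_1_over_n]) auto
      then have "(\<lambda>i. f i s) \<longlonglongrightarrow> ennreal (1 / \<mu> s)"
        using True unfolding f_def by (intro tendsto_ennrealI) simp
      then have "ennreal (1 / \<mu> s) \<le> (SUP i. f i s)"
        by (rule LIMSEQ_le_const2) (metis SUP_upper UNIV_I)
      then show ?thesis using True by simp
    qed simp
  qed
  also have "\<dots> = (SUP i. (\<integral>\<^sup>+ s. f i s \<partial>lborel))"
    by (rule nn_integral_monotone_convergence_SUP[OF f_inc f_meas])
  also have "\<dots> \<le> ennreal B" using f_int by (intro SUP_least)
  finally show False using inf by (simp add: top_unique)
qed

end

section \<open>The difference of two solutions\<close>

text \<open>Both coefficients are controlled by one modulus of the squared distance, valid up to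
  squared distance \<open>a\<close>. The factor \<open>dist u v\<close> in \<open>mod_b\<close> is
  the one that arises from the inner product of \<open>u - v\<close> with
  \<open>b u - b v\<close>.\<close>

locale sde_pair = prob_space M for M :: "'a measure" +
  fixes F :: "real \<Rightarrow> 'a measure" and W :: "real \<Rightarrow> 'a \<Rightarrow> real^'m"
    and \<sigma> :: "real^'d \<Rightarrow> real^'m^'d" and b :: "real^'d \<Rightarrow> real^'d"
    and x y :: "real^'d" and X Y :: "real \<Rightarrow> 'a \<Rightarrow> real^'d"
    and C a T :: real and \<mu> :: "real \<Rightarrow> real"
  assumes BM: "brownian_motion M F W"
    and solX: "sde_solution M F W \<sigma> b x X" and solY: "sde_solution M F W \<sigma> b y Y"
    and cont_\<sigma>: "continuous_on UNIV \<sigma>" and cont_b: "continuous_on UNIV b"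
    and C_pos: "0 < C" and T_pos: "0 < T"
    and \<mu>_cont: "continuous_on UNIV \<mu>" and \<mu>_mono: "mono \<mu>" and \<mu>_nonneg: "\<And>s. 0 \<le> \<mu> s"
    and mod_\<sigma>: "\<And>u v. (dist u v)\<^sup>2 \<le> a \<Longrightarrow> (norm (\<sigma> u - \<sigma> v))\<^sup>2 \<le> C * \<mu> ((dist u v)\<^sup>2)"
    and mod_b: "\<And>u v. (dist u v)\<^sup>2 \<le> a \<Longrightarrow> dist u v * norm (b u - b v) \<le> C * \<mu> ((dist u v)\<^sup>2)"
begin

definition gap :: "real \<Rightarrow> 'a \<Rightarrow> real^'d" where "gap s \<omega> = X s \<omega> - Y s \<omega>"

definition grid :: "nat \<Rightarrow> nat \<Rightarrow> real" where "grid m k = real k * T / real m"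

text \<open>The index \<open>k\<close> runs through the partial sums on one fixed grid with
  \<open>m\<close> steps, which makes the sums adapted along that grid and allows them to be
  stopped.\<close>

definition euler_gap :: "nat \<Rightarrow> nat \<Rightarrow> 'a \<Rightarrow> real^'d" where
  "euler_gap m k \<omega> = (x - y) + (\<Sum>i<k.
     (\<sigma> (X (grid m i) \<omega>) - \<sigma> (Y (grid m i) \<omega>)) *v (W (grid m (Suc i)) \<omega> - W (grid m i) \<omega>)
     + (T / real m) *\<^sub>R (b (X (grid m i) \<omega>) - b (Y (grid m i) \<omega>)))"

lemma grid_nonneg: "0 \<le> grid m k"
  using T_pos by (simp add: grid_def)

lemma grid_noise:
  assumes "0 < m"
  shows "adapted_noise M (\<lambda>k. F (grid m k)) (\<lambda>k \<omega>. W (grid m (Suc k)) \<omega> - W (grid m k) \<omega>)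
    (real CARD('m) * (T / real m))"
proof (rule brownian_increments_adapted_noise[OF BM grid_nonneg])
  show "grid m (Suc k) = grid m k + T / real m" for k
    by (simp add: grid_def algebra_simps add_divide_distrib)
  show "0 < T / real m" using assms T_pos by simp
qed

lemma path_measurable:
  assumes "0 \<le> s" shows "X s \<in> borel_measurable (F s)" "Y s \<in> borel_measurable (F s)"
  using solX solY assms by (auto simp: sde_solution_def)

lemma coefficient_measurable:
  assumes "0 \<le> s"
  shows "(\<lambda>\<omega>. \<sigma> (X s \<omega>) - \<sigma> (Y s \<omega>)) \<in> borel_measurable (F s)"
    and "(\<lambda>\<omega>. b (X s \<omega>) - b (Y s \<omega>)) \<in> borel_measurable (F s)"
    and "gap s \<in> borel_measurable (F s)"
proof -
  have [measurable]: "\<sigma> \<in> borel_measurable borel" "b \<in> borel_measurable borel"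
    using cont_\<sigma> cont_b by (auto intro: borel_measurable_continuous_onI)
  have [measurable]: "X s \<in> borel_measurable (F s)" "Y s \<in> borel_measurable (F s)"
    using path_measurable[OF assms] .
  show "(\<lambda>\<omega>. \<sigma> (X s \<omega>) - \<sigma> (Y s \<omega>)) \<in> borel_measurable (F s)"
    "(\<lambda>\<omega>. b (X s \<omega>) - b (Y s \<omega>)) \<in> borel_measurable (F s)"
    by measurable
  show "gap s \<in> borel_measurable (F s)" unfolding gap_def[abs_def] by measurable
qed

lemma euler_gap_measurable:
  assumes "0 < m" shows "euler_gap m k \<in> borel_measurable (F (grid m k))"
proof -
  interpret noise: adapted_noise M "\<lambda>k. F (grid m k)" "\<lambda>k \<omega>. W (grid m (Suc k)) \<omega> - W (grid m k) \<omega>"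
    "real CARD('m) * (T / real m)"
    by (rule grid_noise[OF assms])
  show ?thesis
    unfolding euler_gap_def
  proof (intro borel_measurable_add borel_measurable_const borel_measurable_sum
      borel_measurable_matrix_vector_mult borel_measurable_scaleR)
    fix i assume "i \<in> {..<k}"
    then have i: "i \<le> k" "Suc i \<le> k" by auto
    show "(\<lambda>\<omega>. \<sigma> (X (grid m i) \<omega>) - \<sigma> (Y (grid m i) \<omega>)) \<in> borel_measurable (F (grid m k))"
      by (rule noise.measurable_F_mono[OF coefficient_measurable(1)[OF grid_nonneg] i(1)])
    show "(\<lambda>\<omega>. b (X (grid m i) \<omega>) - b (Y (grid m i) \<omega>)) \<in> borel_measurable (F (grid m k))"
      by (rule noise.measurable_F_mono[OF coefficient_measurable(2)[OF grid_nonneg] i(1)])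
    show "(\<lambda>\<omega>. W (grid m (Suc i)) \<omega> - W (grid m i) \<omega>) \<in> borel_measurable (F (grid m k))"
      by (rule noise.measurable_F_mono[OF noise.noise_measurable i(2)])
  qed
qed

text \<open>In use, \<open>u\<close> and \<open>v\<close> are the two solutions at a fine time and
  \<open>z\<close> is the stopped Euler sum at the coarse time at or before it. Exchanging
  \<open>z\<close> for \<open>u - v\<close> costs at most \<open>2 * \<kappa> * K\<close>, absorbed
  by \<open>C * \<delta>\<close>. Both terms are then bounded by multiples of
  \<open>\<mu> ((norm z)\<^sup>2) + \<delta>\<close>, which cancels the denominator and leaves a
  constant free of \<open>\<delta>\<close>.\<close>

lemma drift_bound:
  fixes z :: "real^'d"
  assumes uv: "(norm (u - v))\<^sup>2 \<le> a"
    and K: "norm (b u - b v) \<le> K" and \<kappa>: "norm (z - (u - v)) \<le> 2 * \<kappa>" "2 * \<kappa> * K \<le> C * \<delta>"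
    and \<mu>: "\<mu> ((norm (u - v))\<^sup>2) \<le> \<mu> ((norm z)\<^sup>2) + \<delta>" and \<delta>: "0 < \<delta>" and d: "0 \<le> d" and q: "0 \<le> q"
  shows "1 / (\<mu> ((norm z)\<^sup>2) + \<delta>) * (2 * d * (z \<bullet> (b u - b v)) + 2 * (q * d * (norm (\<sigma> u - \<sigma> v))\<^sup>2))
    \<le> (4 * C + 2 * q * C) * d"
proof -
  let ?D = "\<mu> ((norm z)\<^sup>2) + \<delta>"
  have D: "0 < ?D" using \<mu>_nonneg[of "(norm z)\<^sup>2"] \<delta> by simp
  have CD: "C * \<mu> ((norm (u - v))\<^sup>2) \<le> C * ?D" using \<mu> C_pos by (intro mult_left_mono) auto
  have "z \<bullet> (b u - b v) = (u - v) \<bullet> (b u - b v) + (z - (u - v)) \<bullet> (b u - b v)"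
    by (simp add: inner_diff_left)
  also have "\<dots> \<le> norm (u - v) * norm (b u - b v) + norm (z - (u - v)) * norm (b u - b v)"
    by (intro add_mono norm_cauchy_schwarz)
  also have "norm (u - v) * norm (b u - b v) \<le> C * \<mu> ((norm (u - v))\<^sup>2)"
    using mod_b[of u v] uv by (simp add: dist_norm)
  also have "norm (z - (u - v)) * norm (b u - b v) \<le> 2 * \<kappa> * K"
    using \<kappa>(1) K order_trans[OF norm_ge_zero \<kappa>(1)] by (intro mult_mono) auto
  finally have "z \<bullet> (b u - b v) \<le> C * ?D + C * \<delta>" using CD \<kappa>(2) by linarith
  moreover have "C * \<delta> \<le> C * ?D" using C_pos \<mu>_nonneg[of "(norm z)\<^sup>2"] by (intro mult_left_mono) auto
  \<comment> \<open>One multiple of \<open>C * ?D\<close> comes from the modulus of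
    \<open>b\<close>, the other from the exchange of \<open>z\<close> for
    \<open>u - v\<close>.\<close>
  ultimately have 1: "z \<bullet> (b u - b v) \<le> 2 * (C * ?D)" by linarith
  have 2: "(norm (\<sigma> u - \<sigma> v))\<^sup>2 \<le> C * ?D"
    using mod_\<sigma>[of u v] uv CD by (simp add: dist_norm)
  have "2 * d * (z \<bullet> (b u - b v)) + 2 * (q * d * (norm (\<sigma> u - \<sigma> v))\<^sup>2)
      \<le> 2 * d * (2 * (C * ?D)) + 2 * (q * d * (C * ?D))"
    using d q by (intro add_mono mult_left_mono 1 2) auto
  also have "\<dots> = (4 * C + 2 * q * C) * d * ?D" by (simp add: algebra_simps)
  finally show ?thesis using D by (simp add: field_simps)
qed

text \<open>On this event the stopped Euler sum ends with norm at least
  \<open>\<epsilon> / 2\<close>, so Markov's inequality for \<open>g\<close> of its squared norm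
  applies. The expectation is estimated by running \<open>lyapunov_block\<close> over the
  \<open>N\<close> coarse blocks of \<open>n\<close> fine steps each.\<close>

lemma gap_exceedance_bound:
  fixes \<delta> :: real
  defines "g \<equiv> osgood_lyapunov \<mu> \<delta>" and "L \<equiv> 4 * C + 2 * real CARD('m) * C"
  assumes N: "0 < N" and n: "0 < n" and \<epsilon>: "0 < \<epsilon>" "4 * \<epsilon>\<^sup>2 \<le> a" and \<delta>: "0 < \<delta>"
    and \<kappa>: "0 < \<kappa>" "\<kappa> \<le> \<epsilon> / 2" "2 * \<kappa> * K \<le> C * \<delta>" and K0: "0 \<le> K"
    and K: "\<And>u v. norm u \<le> R \<Longrightarrow> norm v \<le> R \<Longrightarrow> norm (\<sigma> u - \<sigma> v) \<le> K \<and> norm (b u - b v) \<le> K"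
    and \<mu>_osc: "\<And>u v. 0 \<le> u \<Longrightarrow> u \<le> 2 * \<epsilon> \<Longrightarrow> 0 \<le> v \<Longrightarrow> v \<le> 2 * \<epsilon> \<Longrightarrow> \<bar>u - v\<bar> \<le> 2 * \<kappa>
        \<Longrightarrow> \<mu> (u\<^sup>2) \<le> \<mu> (v\<^sup>2) + \<delta>"
    and g_pos: "0 < g (\<epsilon>\<^sup>2 / 4)"
  shows "prob {\<omega> \<in> space M. (\<exists>j\<le>N. \<epsilon> < norm (gap (grid (N * n) (j * n)) \<omega>)) \<and>
      (\<forall>k<N * n. norm (X (grid (N * n) k) \<omega>) \<le> R \<and> norm (Y (grid (N * n) k) \<omega>) \<le> R \<and>
        norm (gap (grid (N * n) k) \<omega> - gap (grid (N * n) (k div n * n)) \<omega>) \<le> \<kappa>) \<and>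
      (\<forall>j\<le>N. norm (euler_gap (N * n) (j * n) \<omega> - gap (grid (N * n) (j * n)) \<omega>) \<le> \<kappa>)}
    \<le> (g ((norm (x - y))\<^sup>2) + L * T + 2 * (1 / \<delta>) * (K * T)\<^sup>2 / real N) / g (\<epsilon>\<^sup>2 / 4)" (is "prob ?Ev \<le> _")
proof -
  define m where "m = N * n"
  have m: "0 < m" using N n by (simp add: m_def)
  define d where "d = T / real m"
  have d0: "0 < d" using m T_pos by (simp add: d_def)
  define \<tau> where "\<tau> = grid m"
  define U where "U = euler_gap m"
  define \<xi> where "\<xi> k \<omega> = W (\<tau> (Suc k)) \<omega> - W (\<tau> k) \<omega>" for k \<omega>
  interpret noise: adapted_noise M "\<lambda>k. F (\<tau> k)" \<xi> "real CARD('m) * d"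
    unfolding \<tau>_def \<xi>_def d_def by (rule grid_noise[OF m])
  have \<tau>0: "0 \<le> \<tau> k" for k unfolding \<tau>_def by (rule grid_nonneg)
  \<comment> \<open>\<open>k div n * n\<close> is the fine index of the coarse point at or before
    \<open>k\<close>. The last two clauses are tested only there, and all clauses are known at time
    \<open>\<tau> k\<close>, so the rule does not look ahead.\<close>
  define good where "good k \<omega> \<longleftrightarrow> norm (X (\<tau> k) \<omega>) \<le> R \<and> norm (Y (\<tau> k) \<omega>) \<le> R \<and>
      norm (gap (\<tau> k) \<omega> - gap (\<tau> (k div n * n)) \<omega>) \<le> \<kappa> \<and>
      norm (U (k div n * n) \<omega> - gap (\<tau> (k div n * n)) \<omega>) \<le> \<kappa> \<and>
      norm (gap (\<tau> (k div n * n)) \<omega>) \<le> \<epsilon>" for k \<omega>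
  \<comment> \<open>\<open>act\<close> is a stopping rule: on \<open>act k\<close> the stopped sum \<open>Z\<close> still agrees with \<open>U\<close> up to step \<open>Suc k\<close>.\<close>
  define act where "act k \<omega> \<longleftrightarrow> (\<forall>i\<in>{..k}. good i \<omega>)" for k \<omega>
  define h where "h k \<omega> = (if act k \<omega> then \<sigma> (X (\<tau> k) \<omega>) - \<sigma> (Y (\<tau> k) \<omega>) else 0)" for k \<omega>
  define \<beta> where "\<beta> k \<omega> = (if act k \<omega> then b (X (\<tau> k) \<omega>) - b (Y (\<tau> k) \<omega>) else 0)" for k \<omega>
  define Z where "Z = (\<lambda>q \<omega>. (x - y) + (\<Sum>k<q. h k \<omega> *v \<xi> k \<omega> + d *\<^sub>R \<beta> k \<omega>))"
  have gap_meas: "gap (\<tau> k) \<in> borel_measurable (F (\<tau> l))" if "k \<le> l" for k l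
    by (rule noise.measurable_F_mono[OF coefficient_measurable(3)[OF \<tau>0] that])
  have good_meas: "Measurable.pred (F (\<tau> k)) (good k)" for k
  proof -
    have [measurable]: "X (\<tau> k) \<in> borel_measurable (F (\<tau> k))" "Y (\<tau> k) \<in> borel_measurable (F (\<tau> k))"
      using path_measurable[OF \<tau>0] by auto
    have [measurable]: "gap (\<tau> k) \<in> borel_measurable (F (\<tau> k))"
      "gap (\<tau> (k div n * n)) \<in> borel_measurable (F (\<tau> k))"
      by (intro gap_meas; simp)+
    have [measurable]: "U (k div n * n) \<in> borel_measurable (F (\<tau> k))"
    proof (rule noise.measurable_F_mono)
      show "U (k div n * n) \<in> borel_measurable (F (\<tau> (k div n * n)))"
        unfolding U_def \<tau>_def by (rule euler_gap_measurable[OF m])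
    qed simp
    show ?thesis unfolding good_def[abs_def] by measurable
  qed
  have act_meas: "Measurable.pred (F (\<tau> k)) (act k)" for k
    unfolding act_def[abs_def]
    by (rule pred_intros_finite(3)) (auto intro: noise.measurable_F_mono[OF good_meas])
  have h_meas: "h k \<in> borel_measurable (F (\<tau> k))" and \<beta>_meas: "\<beta> k \<in> borel_measurable (F (\<tau> k))" for k
    unfolding h_def[abs_def] \<beta>_def[abs_def]
    using act_meas[of k] coefficient_measurable(1,2)[OF \<tau>0, of k] by measurable
  have act_good: "good k \<omega>" if "act k \<omega>" for k \<omega> using that by (simp add: act_def)
  have h_bound: "norm (h k \<omega>) \<le> K" and \<beta>_bound: "norm (\<beta> k \<omega>) \<le> K" for k \<omega>
    using act_good[of k \<omega>] K[of "X (\<tau> k) \<omega>" "Y (\<tau> k) \<omega>"] K0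
    by (auto simp: h_def \<beta>_def good_def)
  have Z_eq_U: "Z q \<omega> = U q \<omega>" if "\<And>k. k < q \<Longrightarrow> act k \<omega>" for q \<omega>
    unfolding Z_def U_def euler_gap_def \<tau>_def[symmetric] d_def[symmetric] \<xi>_def[symmetric]
    using that by (auto simp: h_def \<beta>_def intro!: sum.cong)
  have \<rho>: "(\<lambda>s. 1 / (\<mu> s + \<delta>)) \<in> borel_measurable borel"
  proof -
    have [measurable]: "\<mu> \<in> borel_measurable borel"
      using \<mu>_cont by (rule borel_measurable_continuous_onI)
    show ?thesis by measurable
  qed
  have \<rho>0: "0 \<le> 1 / (\<mu> s + \<delta>)" and \<rho>1: "1 / (\<mu> s + \<delta>) \<le> 1 / \<delta>" for s
    using \<mu>_nonneg[of s] \<delta> by (auto intro!: divide_left_mono mult_pos_pos add_nonneg_pos)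
  have g_mono: "mono g" unfolding g_def by (rule mono_osgood_lyapunov[OF \<mu>_cont \<mu>_mono \<mu>_nonneg \<delta>])
  have g0: "g 0 = 0" by (simp add: g_def osgood_lyapunov_def)
  have concave: "g v \<le> g u + 1 / (\<mu> u + \<delta>) * (v - u)" if "0 \<le> u" "0 \<le> v" for u v
    unfolding g_def by (rule osgood_lyapunov_concave[OF \<mu>_cont \<mu>_mono \<mu>_nonneg \<delta> that])
  have L0: "0 \<le> L" using C_pos by (simp add: L_def)
  have drift: "1 / (\<mu> ((norm (Z (j * n) \<omega>))\<^sup>2) + \<delta>) *
      (2 * d * (Z (j * n) \<omega> \<bullet> \<beta> k \<omega>) + 2 * (real CARD('m) * d * (norm (h k \<omega>))\<^sup>2)) \<le> L * d"
    if jk: "j * n \<le> k" "k < Suc j * n" for j k \<omega>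
  proof (cases "act k \<omega>")
    case False
    then show ?thesis using L0 d0 by (simp add: h_def \<beta>_def)
  next
    case True
    let ?u = "X (\<tau> k) \<omega>" and ?v = "Y (\<tau> k) \<omega>" and ?z = "Z (j * n) \<omega>"
    have div: "k div n = j" using jk n by (intro div_nat_eqI) (auto simp: mult.commute)
    \<comment> \<open>\<open>act k\<close> contains all earlier conditions, so the sum has not been
      stopped before the block start.\<close>
    have zU: "?z = U (j * n) \<omega>" using True jk by (intro Z_eq_U) (auto simp: act_def)
    have gk: "norm ?u \<le> R" "norm ?v \<le> R" "norm ((?u - ?v) - gap (\<tau> (j * n)) \<omega>) \<le> \<kappa>"
      "norm (?z - gap (\<tau> (j * n)) \<omega>) \<le> \<kappa>" "norm (gap (\<tau> (j * n)) \<omega>) \<le> \<epsilon>"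
      using act_good[OF True] by (auto simp: good_def div zU gap_def)
    have close: "norm (?z - (?u - ?v)) \<le> 2 * \<kappa>"
      using norm_diff_triangle_le[OF gk(4), of "?u - ?v" \<kappa>] gk(3) by (simp add: norm_minus_commute)
    \<comment> \<open>At the coarse point the gap is at most \<open>\<epsilon>\<close>, and
      \<open>\<kappa> \<le> \<epsilon> / 2\<close> covers the move to the fine point. With
      \<open>4 * \<epsilon>\<^sup>2 \<le> a\<close> the moduli are then applicable.\<close>
    have nu: "norm (?u - ?v) \<le> 2 * \<epsilon>"
      using norm_triangle_ineq[of "(?u - ?v) - gap (\<tau> (j * n)) \<omega>" "gap (\<tau> (j * n)) \<omega>"] gk \<kappa> \<epsilon> by simp
    have nz: "norm ?z \<le> 2 * \<epsilon>"
      using norm_triangle_ineq[of "?z - gap (\<tau> (j * n)) \<omega>" "gap (\<tau> (j * n)) \<omega>"] gk \<kappa> \<epsilon> by simp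
    have "(norm (?u - ?v))\<^sup>2 \<le> (2 * \<epsilon>)\<^sup>2" using nu by (intro power_mono) auto
    then have sq: "(norm (?u - ?v))\<^sup>2 \<le> a" using \<epsilon> by (simp add: power_mult_distrib)
    have "\<bar>norm (?u - ?v) - norm ?z\<bar> \<le> 2 * \<kappa>"
      using norm_triangle_ineq3[of ?z "?u - ?v"] close by linarith
    then have osc: "\<mu> ((norm (?u - ?v))\<^sup>2) \<le> \<mu> ((norm ?z)\<^sup>2) + \<delta>"
      using nu nz by (intro \<mu>_osc) auto
    have "norm (b ?u - b ?v) \<le> K" using K gk by blast
    from drift_bound[OF sq this close \<kappa>(3) osc \<delta> less_imp_le[OF d0], of "real CARD('m)"]
    show ?thesis using True by (simp add: h_def \<beta>_def L_def)
  qed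
  let ?err = "2 * (1 / \<delta>) * (K * (d * real n))\<^sup>2"
  have block: "integrable M (\<lambda>\<omega>. g ((norm (Z (Suc j * n) \<omega>))\<^sup>2))"
    "expectation (\<lambda>\<omega>. g ((norm (Z (Suc j * n) \<omega>))\<^sup>2))
      \<le> expectation (\<lambda>\<omega>. g ((norm (Z (j * n) \<omega>))\<^sup>2)) + L * (d * real n) + ?err" for j
  proof -
    have pq: "j * n \<le> Suc j * n" by simp
    have diff: "Suc j * n - j * n = n" by simp
    show "integrable M (\<lambda>\<omega>. g ((norm (Z (Suc j * n) \<omega>))\<^sup>2))"
      unfolding Z_def
      by (rule noise.lyapunov_block(1)[OF h_meas h_bound \<beta>_meas \<beta>_bound less_imp_le[OF d0] pq g_mono g0
            \<rho> \<rho>0 \<rho>1 concave, where L=L])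
        (use drift[of j] in \<open>auto simp: Z_def\<close>)
    have "expectation (\<lambda>\<omega>. g ((norm (Z (Suc j * n) \<omega>))\<^sup>2))
      \<le> expectation (\<lambda>\<omega>. g ((norm (Z (j * n) \<omega>))\<^sup>2)) + L * (d * real (Suc j * n - j * n))
        + 2 * (1 / \<delta>) * (K * (d * real (Suc j * n - j * n)))\<^sup>2"
      unfolding Z_def
      by (rule noise.lyapunov_block(2)[OF h_meas h_bound \<beta>_meas \<beta>_bound less_imp_le[OF d0] pq g_mono g0
            \<rho> \<rho>0 \<rho>1 concave, where L=L])
        (use drift[of j] in \<open>auto simp: Z_def\<close>)
    then show "expectation (\<lambda>\<omega>. g ((norm (Z (Suc j * n) \<omega>))\<^sup>2))
      \<le> expectation (\<lambda>\<omega>. g ((norm (Z (j * n) \<omega>))\<^sup>2)) + L * (d * real n) + ?err"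
      unfolding diff .
  qed
  have total: "expectation (\<lambda>\<omega>. g ((norm (Z (j * n) \<omega>))\<^sup>2))
      \<le> g ((norm (x - y))\<^sup>2) + real j * (L * (d * real n) + ?err)" for j
  proof (induction j)
    case 0
    show ?case by (simp add: Z_def prob_space)
  next
    case (Suc j)
    have step: "g0' + real (Suc j) * (u + e) = g0' + real j * (u + e) + u + e" for g0' u e :: real
      by (simp add: algebra_simps)
    show ?case using Suc block(2)[of j] unfolding step by linarith
  qed
  have dn: "d * real n = T / real N" using n by (simp add: d_def m_def)
  have EZ: "expectation (\<lambda>\<omega>. g ((norm (Z m \<omega>))\<^sup>2))
      \<le> g ((norm (x - y))\<^sup>2) + L * T + 2 * (1 / \<delta>) * (K * T)\<^sup>2 / real N"
  proof -
    have "real N * (L * (T / real N) + 2 * (1 / \<delta>) * (K * (T / real N))\<^sup>2)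
        = L * T + 2 * (1 / \<delta>) * (K * T)\<^sup>2 / real N"
      using N by (simp add: field_simps power2_eq_square)
    then show ?thesis using total[of N] unfolding dn m_def by simp
  qed
  have Z_int: "integrable M (\<lambda>\<omega>. g ((norm (Z m \<omega>))\<^sup>2))"
    using block(1)[of "N - 1"] N by (simp add: m_def)
  have sub: "?Ev \<subseteq> {\<omega> \<in> space M. g (\<epsilon>\<^sup>2 / 4) \<le> g ((norm (Z m \<omega>))\<^sup>2)}"
  proof
    fix \<omega> assume \<omega>: "\<omega> \<in> ?Ev"
    then have ex: "\<exists>j. j \<le> N \<and> \<epsilon> < norm (gap (\<tau> (j * n)) \<omega>)"
      and reg: "\<And>k. k < m \<Longrightarrow> norm (X (\<tau> k) \<omega>) \<le> R \<and> norm (Y (\<tau> k) \<omega>) \<le> R \<and>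
        norm (gap (\<tau> k) \<omega> - gap (\<tau> (k div n * n)) \<omega>) \<le> \<kappa>"
      and near: "\<And>j. j \<le> N \<Longrightarrow> norm (U (j * n) \<omega> - gap (\<tau> (j * n)) \<omega>) \<le> \<kappa>"
      by (auto simp: m_def \<tau>_def U_def)
    \<comment> \<open>The first coarse index at which the gap exceeds \<open>\<epsilon>\<close>. All
      fine steps before \<open>J * n\<close> are good, and the condition fails at
      \<open>J * n\<close> itself, so the stopped sum follows the Euler sum exactly up to there and
      stays constant afterwards.\<close>
    define J where "J = (LEAST j. j \<le> N \<and> \<epsilon> < norm (gap (\<tau> (j * n)) \<omega>))"
    have J: "J \<le> N" "\<epsilon> < norm (gap (\<tau> (J * n)) \<omega>)"
      using LeastI_ex[OF ex] unfolding J_def by auto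
    have before: "norm (gap (\<tau> (j * n)) \<omega>) \<le> \<epsilon>" if "j < J" for j
      using not_less_Least[of j "\<lambda>j. j \<le> N \<and> \<epsilon> < norm (gap (\<tau> (j * n)) \<omega>)"] that J(1)
      unfolding J_def by force
    have good: "good k \<omega>" if "k < J * n" for k
    proof -
      have "k div n < J" using that n by (simp add: less_mult_imp_div_less)
      moreover have "J * n \<le> m" unfolding m_def using J(1) by simp
      ultimately show ?thesis
        using reg[of k] near[of "k div n"] before[of "k div n"] that J(1) by (auto simp: good_def)
    qed
    have ZU: "Z (J * n) \<omega> = U (J * n) \<omega>" using good by (intro Z_eq_U) (auto simp: act_def)
    have stop: "\<not> act k \<omega>" if "J * n \<le> k" for k
    proof
      assume "act k \<omega>"
      then have "good (J * n) \<omega>" using that by (auto simp: act_def)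
      then show False using J(2) n by (simp add: good_def)
    qed
    have "Z m \<omega> = Z (J * n) \<omega>"
    proof -
      have le: "J * n \<le> m" using J(1) by (simp add: m_def)
      have "(\<Sum>k<m. h k \<omega> *v \<xi> k \<omega> + d *\<^sub>R \<beta> k \<omega>) = (\<Sum>k<J * n. h k \<omega> *v \<xi> k \<omega> + d *\<^sub>R \<beta> k \<omega>)"
        using le stop by (intro sum.mono_neutral_right) (auto simp: h_def \<beta>_def not_less)
      then show ?thesis by (simp add: Z_def)
    qed
    \<comment> \<open>The Euler sum is within \<open>\<kappa>\<close> of the gap at the stopping
      point, hence of norm more than \<open>\<epsilon> - \<kappa>\<close>, which is at least
      \<open>\<epsilon> / 2\<close>.\<close>
    then have "norm (gap (\<tau> (J * n)) \<omega>) - \<kappa> \<le> norm (Z m \<omega>)"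
      using near[OF J(1)] norm_triangle_ineq2[of "gap (\<tau> (J * n)) \<omega>" "U (J * n) \<omega>"]
      by (simp add: ZU norm_minus_commute)
    then have "\<epsilon> / 2 \<le> norm (Z m \<omega>)" using J(2) \<kappa> by linarith
    then have "(\<epsilon> / 2)\<^sup>2 \<le> (norm (Z m \<omega>))\<^sup>2" using \<epsilon> by (intro power_mono) auto
    then have "g (\<epsilon>\<^sup>2 / 4) \<le> g ((norm (Z m \<omega>))\<^sup>2)"
      using monoD[OF g_mono] by (simp add: power_divide)
    then show "\<omega> \<in> {\<omega> \<in> space M. g (\<epsilon>\<^sup>2 / 4) \<le> g ((norm (Z m \<omega>))\<^sup>2)}" using \<omega> by simp
  qed
  have "prob ?Ev \<le> prob {\<omega> \<in> space M. g (\<epsilon>\<^sup>2 / 4) \<le> g ((norm (Z m \<omega>))\<^sup>2)}"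
    using borel_measurable_integrable[OF Z_int] by (intro finite_measure_mono sub) measurable
  also have "\<dots> \<le> expectation (\<lambda>\<omega>. g ((norm (Z m \<omega>))\<^sup>2)) / g (\<epsilon>\<^sup>2 / 4)"
    using monoD[OF g_mono, of 0] g0 g_pos
    by (intro integral_Markov_inequality_measure[OF Z_int, where A="{}"]) auto
  also have "\<dots> \<le> (g ((norm (x - y))\<^sup>2) + L * T + 2 * (1 / \<delta>) * (K * T)\<^sup>2 / real N) / g (\<epsilon>\<^sup>2 / 4)"
    using EZ g_pos by (intro divide_right_mono) auto
  finally show ?thesis .
qed

section \<open>From coarse grid points to the whole time interval\<close>

lemma gap_measurable: "0 \<le> s \<Longrightarrow> gap s \<in> borel_measurable M"
  using measurable_from_subalg[OF _ coefficient_measurable(3)] BM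
  by (auto simp: brownian_motion_def is_filtration_def)

lemma path_measurable_M:
  assumes "0 \<le> s" shows "X s \<in> borel_measurable M" "Y s \<in> borel_measurable M"
  using measurable_from_subalg[OF _ path_measurable(1)[OF assms]]
    measurable_from_subalg[OF _ path_measurable(2)[OF assms]] BM
  by (auto simp: brownian_motion_def is_filtration_def)

lemma path_continuous:
  assumes "\<omega> \<in> space M"
  shows "continuous_on {0..T} (\<lambda>s. X s \<omega>)" "continuous_on {0..T} (\<lambda>s. Y s \<omega>)"
    "continuous_on {0..T} (\<lambda>s. gap s \<omega>)"
proof -
  show *: "continuous_on {0..T} (\<lambda>s. X s \<omega>)" "continuous_on {0..T} (\<lambda>s. Y s \<omega>)"
    using solX solY assms unfolding sde_solution_def by (auto intro: continuous_on_subset)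
  show "continuous_on {0..T} (\<lambda>s. gap s \<omega>)"
    unfolding gap_def by (intro continuous_intros *)
qed

text \<open>The first \<open>j * n\<close> steps of the grid with \<open>N * n\<close> steps on
  \<open>{0..T}\<close> form the uniform grid with \<open>j * n\<close> steps on the interval up to
  \<open>real j * T / real N\<close>.\<close>

lemma euler_gap_eq:
  assumes "0 < N" "0 < j" "0 < n"
  shows "euler_gap (N * n) (j * n) \<omega> = sde_euler_sum W \<sigma> b x X (real j * T / real N) (j * n) \<omega>
    - sde_euler_sum W \<sigma> b y Y (real j * T / real N) (j * n) \<omega>"
proof -
  let ?s = "real j * T / real N"
  have g: "grid (N * n) i = real i * ?s / real (j * n)" for i
    using assms by (simp add: grid_def)
  have d: "T / real (N * n) = ?s / real (j * n)" using assms by simp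
  show ?thesis
    unfolding euler_gap_def sde_euler_sum_def ito_riemann_sum_def g d
    by (simp only: matrix_vector_mult_diff_rdistrib scaleR_diff_right sum.distrib sum_subtractf
        add_diff_eq diff_add_eq diff_diff_eq2 algebra_simps)
qed

text \<open>For \<open>j = 0\<close> both sides equal \<open>x - y\<close>. Otherwise this is
  convergence in probability of the two Euler sums at the fixed time
  \<open>real j * T / real N\<close>, along the subsequence \<open>j * n\<close>.\<close>

lemma euler_gap_converges:
  assumes N: "0 < N" and \<kappa>: "0 < \<kappa>"
  shows "(\<lambda>n. prob {\<omega> \<in> space M. \<kappa> < norm (euler_gap (N * n) (j * n) \<omega> - gap (real j * T / real N) \<omega>)})
    \<longlonglongrightarrow> 0"
proof (cases "j = 0")
  case True
  have "{\<omega> \<in> space M. \<kappa> < norm (euler_gap (N * n) (j * n) \<omega> - gap (real j * T / real N) \<omega>)} = {}" for n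
    using True \<kappa> solX solY by (auto simp: euler_gap_def gap_def sde_solution_def)
  then show ?thesis by (simp only: measure_empty tendsto_const)
next
  case False
  let ?s = "real j * T / real N"
  have s: "0 < ?s" using False N T_pos by simp
  note convX = sde_euler_sum_converges[OF BM solX cont_\<sigma> cont_b s]
  note convY = sde_euler_sum_converges[OF BM solY cont_\<sigma> cont_b s]
  let ?EX = "sde_euler_sum W \<sigma> b x X ?s" and ?EY = "sde_euler_sum W \<sigma> b y Y ?s"
  let ?A = "\<lambda>n. {\<omega> \<in> space M. dist (?EX n \<omega>) (X ?s \<omega>) > \<kappa> / 2}"
  let ?B = "\<lambda>n. {\<omega> \<in> space M. dist (?EY n \<omega>) (Y ?s \<omega>) > \<kappa> / 2}"
  have [measurable]: "X ?s \<in> borel_measurable M" "Y ?s \<in> borel_measurable M"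
    "?EX n \<in> borel_measurable M" "?EY n \<in> borel_measurable M" for n
    using path_measurable_M[OF less_imp_le[OF s]] convX(1) convY(1) by auto
  have mA: "?A n \<in> sets M" and mB: "?B n \<in> sets M" for n by measurable
  have lim: "filterlim (\<lambda>n. j * n) sequentially sequentially"
    using False by (intro mult_nat_left_at_top) simp
  have "(\<lambda>n. prob (?A n)) \<longlonglongrightarrow> 0" "(\<lambda>n. prob (?B n)) \<longlonglongrightarrow> 0"
    using convX(2) convY(2) \<kappa> unfolding conv_in_prob_def by (meson half_gt_zero)+
  from this[THEN filterlim_compose[OF _ lim]]
  have l: "(\<lambda>n. prob (?A (j * n)) + prob (?B (j * n))) \<longlonglongrightarrow> 0"
    using tendsto_add[of "\<lambda>n. prob (?A (j * n))" 0 sequentially "\<lambda>n. prob (?B (j * n))" 0] by simp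
  have le: "prob {\<omega> \<in> space M. \<kappa> < norm (euler_gap (N * n) (j * n) \<omega> - gap ?s \<omega>)}
      \<le> prob (?A (j * n)) + prob (?B (j * n))" if "0 < n" for n
  proof -
    have "{\<omega> \<in> space M. \<kappa> < norm (euler_gap (N * n) (j * n) \<omega> - gap ?s \<omega>)} \<subseteq> ?A (j * n) \<union> ?B (j * n)"
    proof
      fix \<omega> assume \<omega>: "\<omega> \<in> {\<omega> \<in> space M. \<kappa> < norm (euler_gap (N * n) (j * n) \<omega> - gap ?s \<omega>)}"
      have "euler_gap (N * n) (j * n) \<omega> - gap ?s \<omega> = (?EX (j * n) \<omega> - X ?s \<omega>) - (?EY (j * n) \<omega> - Y ?s \<omega>)"
        using euler_gap_eq[OF N _ that, of j \<omega>] False by (simp add: gap_def)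
      then have "norm (euler_gap (N * n) (j * n) \<omega> - gap ?s \<omega>)
          \<le> dist (?EX (j * n) \<omega>) (X ?s \<omega>) + dist (?EY (j * n) \<omega>) (Y ?s \<omega>)"
        unfolding dist_norm by (metis norm_triangle_ineq4)
      then show "\<omega> \<in> ?A (j * n) \<union> ?B (j * n)" using \<omega> by auto
    qed
    then have "prob {\<omega> \<in> space M. \<kappa> < norm (euler_gap (N * n) (j * n) \<omega> - gap ?s \<omega>)} \<le> prob (?A (j * n) \<union> ?B (j * n))"
      using mA mB by (intro finite_measure_mono) auto
    also have "\<dots> \<le> prob (?A (j * n)) + prob (?B (j * n))" by (rule measure_Un_le[OF mA mB])
    finally show ?thesis .
  qed
  show ?thesis
    by (rule tendsto_sandwich[OF _ _ tendsto_const l])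
      (use le in \<open>auto intro!: eventually_mono[OF eventually_gt_at_top[of 0]]\<close>)
qed

text \<open>Up to an arbitrary \<open>\<theta>\<close>: choose \<open>r\<close> so that large paths
  have probability below \<open>\<theta>\<close>, then \<open>K\<close> and \<open>\<kappa>\<close>,
  then for each \<open>N\<close> a refinement \<open>n N\<close> good enough at all coarse points,
  and let \<open>N\<close> tend to infinity. Only the estimate of
  \<open>gap_exceedance_bound\<close> survives, without its \<open>1 / real N\<close> term.\<close>

lemma gap_sup_bound:
  fixes \<delta> :: real
  defines "g \<equiv> osgood_lyapunov \<mu> \<delta>" and "L \<equiv> 4 * C + 2 * real CARD('m) * C"
  assumes \<epsilon>: "0 < \<epsilon>" "4 * \<epsilon>\<^sup>2 \<le> a" and \<delta>: "0 < \<delta>" and g_pos: "0 < g (\<epsilon>\<^sup>2 / 4)"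
  shows "{\<omega> \<in> space M. \<exists>s\<in>{0..T}. \<epsilon> < norm (gap s \<omega>)} \<in> sets M" (is "?S \<in> _")
    and "prob {\<omega> \<in> space M. \<exists>s\<in>{0..T}. \<epsilon> < norm (gap s \<omega>)}
      \<le> (g ((norm (x - y))\<^sup>2) + L * T) / g (\<epsilon>\<^sup>2 / 4)"
proof -
  show S_meas: "?S \<in> sets M"
  proof (rule exceed_event_measurable[OF _ _ T_pos])
    show "(\<lambda>\<omega>. norm (gap s \<omega>)) \<in> borel_measurable M" if "0 \<le> s" for s
      using gap_measurable[OF that] by measurable
    show "continuous_on {0..T} (\<lambda>s. norm (gap s \<omega>))" if "\<omega> \<in> space M" for \<omega>
      by (intro continuous_intros path_continuous(3) that)
  qed
  show "prob ?S \<le> (g ((norm (x - y))\<^sup>2) + L * T) / g (\<epsilon>\<^sup>2 / 4)"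
  proof (rule field_le_epsilon)
    fix \<theta> :: real assume \<theta>: "0 < \<theta>"
    define A where "A r = {\<omega> \<in> space M. \<exists>s\<in>{0..T}. real r < max (norm (X s \<omega>)) (norm (Y s \<omega>))}" for r
    have A_meas: "A r \<in> sets M" for r
      unfolding A_def
    proof (rule exceed_event_measurable[OF _ _ T_pos])
      show "(\<lambda>\<omega>. max (norm (X s \<omega>)) (norm (Y s \<omega>))) \<in> borel_measurable M" if "0 \<le> s" for s
        using path_measurable_M[OF that] by measurable
      show "continuous_on {0..T} (\<lambda>s. max (norm (X s \<omega>)) (norm (Y s \<omega>)))" if "\<omega> \<in> space M" for \<omega>
        by (intro continuous_intros path_continuous that)
    qed
    have "(\<lambda>r. prob (A r)) \<longlonglongrightarrow> 0"
    proof (rule prob_tendsto_zero[OF A_meas])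
      fix \<omega> assume \<omega>: "\<omega> \<in> space M"
      have "compact ((\<lambda>s. max (norm (X s \<omega>)) (norm (Y s \<omega>))) ` {0..T})"
        by (intro compact_continuous_image continuous_intros path_continuous \<omega>) simp
      then obtain B where B: "\<And>s. s \<in> {0..T} \<Longrightarrow> \<bar>max (norm (X s \<omega>)) (norm (Y s \<omega>))\<bar> \<le> B"
        using compact_imp_bounded bounded_iff by (metis (no_types, lifting) image_eqI real_norm_def)
      show "\<forall>\<^sub>F r in sequentially. \<omega> \<notin> A r"
        using eventually_real_gt[of B]
      proof eventually_elim
        case (elim r)
        then show ?case using B unfolding A_def by fastforce
      qed
    qed
    from order_tendstoD(2)[OF this \<theta>] obtain r where r: "prob (A r) < \<theta>"
      by (auto dest!: eventually_happens)
    have "bounded (\<sigma> ` cball 0 (real r))" "bounded (b ` cball 0 (real r))"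
      by (intro compact_imp_bounded compact_continuous_image compact_cball
          continuous_on_subset[OF cont_\<sigma>] continuous_on_subset[OF cont_b] subset_UNIV)+
    then obtain K1 K2 where K12: "\<And>u. norm u \<le> real r \<Longrightarrow> norm (\<sigma> u) \<le> K1"
      "\<And>u. norm u \<le> real r \<Longrightarrow> norm (b u) \<le> K2"
      unfolding bounded_iff by (metis image_eqI mem_cball_0)
    define K where "K = max (K1 + K1) (max (K2 + K2) 0)"
    have K0: "0 \<le> K" by (simp add: K_def le_max_iff_disj)
    have K: "norm (\<sigma> u - \<sigma> v) \<le> K \<and> norm (b u - b v) \<le> K"
      if "norm u \<le> real r" "norm v \<le> real r" for u v
    proof
      have "norm (\<sigma> u - \<sigma> v) \<le> K1 + K1"
        using norm_triangle_ineq4[of "\<sigma> u" "\<sigma> v"] K12(1)[OF that(1)] K12(1)[OF that(2)] by linarith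
      then show "norm (\<sigma> u - \<sigma> v) \<le> K" by (simp add: K_def le_max_iff_disj)
      have "norm (b u - b v) \<le> K2 + K2"
        using norm_triangle_ineq4[of "b u" "b v"] K12(2)[OF that(1)] K12(2)[OF that(2)] by linarith
      then show "norm (b u - b v) \<le> K" by (simp add: K_def le_max_iff_disj)
    qed
    have "uniformly_continuous_on {0..2 * \<epsilon>} (\<lambda>u. \<mu> (u\<^sup>2))"
      by (intro compact_uniformly_continuous continuous_on_compose2[OF \<mu>_cont] continuous_intros) auto
    then obtain \<kappa>1 where \<kappa>1: "0 < \<kappa>1" "\<And>u v. u \<in> {0..2 * \<epsilon>} \<Longrightarrow> v \<in> {0..2 * \<epsilon>} \<Longrightarrow> dist u v < \<kappa>1
        \<Longrightarrow> dist (\<mu> (u\<^sup>2)) (\<mu> (v\<^sup>2)) < \<delta>"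
      using \<delta> unfolding uniformly_continuous_on_def by metis
    \<comment> \<open>The three entries give \<open>\<kappa> \<le> \<epsilon> / 2\<close>, the
      strict \<open>2 * \<kappa> < \<kappa>1\<close> for the oscillation of \<open>\<mu>\<close>,
      and \<open>2 * \<kappa> * K \<le> C * \<delta>\<close>; \<open>K + 1\<close> avoids division
      by zero.\<close>
    define \<kappa> where "\<kappa> = min (\<epsilon> / 2) (min (\<kappa>1 / 3) (C * \<delta> / (2 * (K + 1))))"
    have \<kappa>_le: "\<kappa> \<le> \<epsilon> / 2" "\<kappa> \<le> \<kappa>1 / 3" "\<kappa> \<le> C * \<delta> / (2 * (K + 1))"
      unfolding \<kappa>_def by (simp_all only: min_le_iff_disj order_refl simp_thms)
    have \<kappa>: "0 < \<kappa>" "\<kappa> \<le> \<epsilon> / 2" "2 * \<kappa> < \<kappa>1"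
      using \<epsilon> \<kappa>1(1) C_pos \<delta> K0 \<kappa>_le(1,2) by (simp_all add: \<kappa>_def)
    have "2 * \<kappa> * K \<le> 2 * \<kappa> * (K + 1)" using \<kappa> by simp
    also have "\<dots> \<le> 2 * (C * \<delta> / (2 * (K + 1))) * (K + 1)"
      using K0 \<kappa>_le(3) by (intro mult_right_mono mult_left_mono) auto
    also have "\<dots> = C * \<delta>" using K0 by (simp add: field_simps)
    finally have \<kappa>K: "2 * \<kappa> * K \<le> C * \<delta>" .
    have \<mu>_osc: "\<mu> (u\<^sup>2) \<le> \<mu> (v\<^sup>2) + \<delta>"
      if "0 \<le> u" "u \<le> 2 * \<epsilon>" "0 \<le> v" "v \<le> 2 * \<epsilon>" "\<bar>u - v\<bar> \<le> 2 * \<kappa>" for u v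
      using \<kappa>1(2)[of u v] that \<kappa>(3) by (auto simp: dist_real_def)
    define bad where "bad N n j = {\<omega> \<in> space M. \<kappa> < norm (euler_gap (N * n) (j * n) \<omega> - gap (real j * T / real N) \<omega>)}" for N n j
    \<comment> \<open>With \<open>N\<close> fixed there are finitely many coarse points, so their
      failure probabilities can be made small together. The guard on \<open>N\<close> lets
      \<open>n N\<close> be positive for every \<open>N\<close>, including 0.\<close>
    have "\<exists>n>0. 0 < N \<longrightarrow> (\<Sum>j\<le>N. prob (bad N n j)) < 1 / (real N + 1)" for N
    proof (cases "0 < N")
      case True
      have "(\<lambda>n. \<Sum>j\<le>N. prob (bad N n j)) \<longlonglongrightarrow> (\<Sum>j\<le>N. 0)"
        unfolding bad_def by (intro tendsto_sum euler_gap_converges True \<kappa>)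
      then have "\<forall>\<^sub>F n in sequentially. (\<Sum>j\<le>N. prob (bad N n j)) < 1 / (real N + 1)"
        by (intro order_tendstoD(2)) auto
      with eventually_gt_at_top[of 0]
      have "\<forall>\<^sub>F n in sequentially. 0 < n \<and> (\<Sum>j\<le>N. prob (bad N n j)) < 1 / (real N + 1)"
        by eventually_elim auto
      from eventually_happens'[OF sequentially_bot this] show ?thesis by blast
    qed auto
    then obtain n where n: "\<And>N. 0 < n N"
      "\<And>N. 0 < N \<Longrightarrow> (\<Sum>j\<le>N. prob (bad N (n N) j)) < 1 / (real N + 1)" by metis
    define SN where "SN N = {\<omega> \<in> space M. \<exists>j\<le>N. \<epsilon> < norm (gap (real j * T / real N) \<omega>)}" for N
    define OS where "OS N = {\<omega> \<in> space M. \<exists>k<N * n N. \<kappa> < norm (gap (grid (N * n N) k) \<omega>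
        - gap (grid (N * n N) (k div n N * n N)) \<omega>)}" for N
    define Ev where "Ev N = {\<omega> \<in> space M. (\<exists>j\<le>N. \<epsilon> < norm (gap (grid (N * n N) (j * n N)) \<omega>)) \<and>
      (\<forall>k<N * n N. norm (X (grid (N * n N) k) \<omega>) \<le> real r \<and> norm (Y (grid (N * n N) k) \<omega>) \<le> real r \<and>
        norm (gap (grid (N * n N) k) \<omega> - gap (grid (N * n N) (k div n N * n N)) \<omega>) \<le> \<kappa>) \<and>
      (\<forall>j\<le>N. norm (euler_gap (N * n N) (j * n N) \<omega> - gap (grid (N * n N) (j * n N)) \<omega>) \<le> \<kappa>)}" for N
    have gap_meas[measurable]: "gap (grid m k) \<in> borel_measurable M"
      "X (grid m k) \<in> borel_measurable M" "Y (grid m k) \<in> borel_measurable M" for m k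
      by (intro gap_measurable path_measurable_M grid_nonneg)+
    have gap_meas'[measurable]: "gap (real j * T / real N) \<in> borel_measurable M" for j N
      using gap_meas(1)[of N j] by (simp add: grid_def)
    have euler_meas[measurable]: "euler_gap (N * n N) k \<in> borel_measurable M" if "0 < N" for N k
      using measurable_from_subalg[OF _ euler_gap_measurable[of "N * n N" k]] BM that n(1)
      by (auto simp: brownian_motion_def is_filtration_def)
    have SN_meas: "SN N \<in> sets M" for N unfolding SN_def by measurable
    have OS_meas: "OS N \<in> sets M" for N unfolding OS_def by measurable
    have bad_meas: "bad N (n N) j \<in> sets M" if "0 < N" for N j
      unfolding bad_def using euler_meas[OF that] by measurable
    have Ev_meas: "Ev N \<in> sets M" if "0 < N" for N
      unfolding Ev_def using euler_meas[OF that] by measurable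
    have coarse: "grid (N * n N) (j * n N) = real j * T / real N" for N j
      using n(1)[of N] by (simp add: grid_def)
    \<comment> \<open>The exceptional events are, in order: an exceedance missed by the coarse grid,
      a large path, a large oscillation within a block, and a bad approximation at a coarse point.
      Off these events the exceedance lies in \<open>Ev N\<close>.\<close>
    have cover: "?S \<subseteq> (?S - SN N) \<union> (A r \<union> (OS N \<union> ((\<Union>j\<le>N. bad N (n N) j) \<union> Ev N)))" if "0 < N" for N
    proof
      fix \<omega> assume \<omega>: "\<omega> \<in> ?S"
      show "\<omega> \<in> (?S - SN N) \<union> (A r \<union> (OS N \<union> ((\<Union>j\<le>N. bad N (n N) j) \<union> Ev N)))"
      proof (rule ccontr)
        assume no: "\<not> ?thesis"
        have sp: "\<omega> \<in> space M" using \<omega> by simp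
        have 1: "\<exists>j\<le>N. \<epsilon> < norm (gap (grid (N * n N) (j * n N)) \<omega>)"
          using no \<omega> unfolding coarse SN_def by blast
        have 2: "norm (X (grid (N * n N) k) \<omega>) \<le> real r \<and> norm (Y (grid (N * n N) k) \<omega>) \<le> real r"
          if "k < N * n N" for k
        proof -
          have "grid (N * n N) k \<in> {0..T}"
            unfolding grid_def using that T_pos by (intro grid_time_in) auto
          moreover have "\<omega> \<notin> A r" using no by blast
          ultimately show ?thesis using sp unfolding A_def by (force simp: not_less)
        qed
        have 3: "norm (gap (grid (N * n N) k) \<omega> - gap (grid (N * n N) (k div n N * n N)) \<omega>) \<le> \<kappa>"
          if "k < N * n N" for k
        proof -
          have "\<omega> \<notin> OS N" using no by blast
          then show ?thesis using sp that unfolding OS_def by (force simp: not_less)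
        qed
        have 4: "norm (euler_gap (N * n N) (j * n N) \<omega> - gap (grid (N * n N) (j * n N)) \<omega>) \<le> \<kappa>" if "j \<le> N" for j
        proof -
          have "\<omega> \<notin> bad N (n N) j" using no that by blast
          then show ?thesis using sp unfolding bad_def coarse by (force simp: not_less)
        qed
        have "\<omega> \<in> Ev N" unfolding Ev_def using sp 1 2 3 4 by simp
        then show False using no by blast
      qed
    qed
    let ?rhs = "\<lambda>N. (g ((norm (x - y))\<^sup>2) + L * T + 2 * (1 / \<delta>) * (K * T)\<^sup>2 / real N) / g (\<epsilon>\<^sup>2 / 4)"
    have bound: "prob ?S \<le> prob (?S - SN N) + (\<theta> + (prob (OS N) + (1 / (real N + 1) + ?rhs N)))" if N: "0 < N" for N
    proof -
      let ?B = "\<Union>j\<le>N. bad N (n N) j"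
      have B_meas: "?B \<in> sets M" using bad_meas[OF N] by (intro sets.finite_UN) auto
      have "prob ?B \<le> (\<Sum>j\<le>N. prob (bad N (n N) j))"
        using bad_meas[OF N] by (intro measure_UNION_le) auto
      then have pB: "prob ?B \<le> 1 / (real N + 1)" using n(2)[OF N] by simp
      have pE: "prob (Ev N) \<le> ?rhs N"
        using gap_exceedance_bound[OF N n(1)[of N] \<epsilon> \<delta> \<kappa>(1,2) \<kappa>K K0 K \<mu>_osc] g_pos
        unfolding Ev_def g_def L_def by simp
      note Em = Ev_meas[OF N]
      have "prob ?S \<le> prob ((?S - SN N) \<union> (A r \<union> (OS N \<union> (?B \<union> Ev N))))"
        using S_meas SN_meas A_meas OS_meas B_meas Em
        by (intro finite_measure_mono cover[OF N] sets.Un sets.Diff)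
      also have "\<dots> \<le> prob (?S - SN N) + (prob (A r) + (prob (OS N) + (prob ?B + prob (Ev N))))"
        using S_meas SN_meas A_meas OS_meas B_meas Em
        by (intro order_trans[OF measure_Un_le] add_left_mono sets.Un sets.Diff order_refl)
      finally show ?thesis using r pB pE by linarith
    qed
    have l1: "(\<lambda>N. prob (?S - SN N)) \<longlonglongrightarrow> 0"
    proof (rule prob_tendsto_zero)
      show "?S - SN N \<in> sets M" for N using S_meas SN_meas by (rule sets.Diff)
      fix \<omega> assume \<omega>: "\<omega> \<in> space M"
      show "\<forall>\<^sub>F N in sequentially. \<omega> \<notin> ?S - SN N"
      proof (cases "\<omega> \<in> ?S")
        case True
        then obtain s where s: "s \<in> {0..T}" "\<epsilon> < norm (gap s \<omega>)" by auto
        have "continuous_on {0..T} (\<lambda>s. norm (gap s \<omega>))"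
          by (intro continuous_intros path_continuous(3) \<omega>)
        from eventually_grid_exceeds[OF this s T_pos] show ?thesis
          by eventually_elim (use \<omega> in \<open>auto simp: SN_def\<close>)
      qed simp
    qed
    have l2: "(\<lambda>N. prob (OS N)) \<longlonglongrightarrow> 0"
    proof (rule prob_tendsto_zero[OF OS_meas])
      fix \<omega> assume \<omega>: "\<omega> \<in> space M"
      from eventually_block_oscillation_small[OF path_continuous(3)[OF \<omega>] T_pos \<kappa>(1) n(1)]
      show "\<forall>\<^sub>F N in sequentially. \<omega> \<notin> OS N"
        by eventually_elim (auto simp: OS_def grid_def dist_norm not_less simp del: of_nat_mult)
    qed
    have l3: "(\<lambda>N. 1 / (real N + 1)) \<longlonglongrightarrow> 0"
      using LIMSEQ_Suc[OF lim_1_over_n[where 'a=real]] by (simp add: add.commute)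
    have l4: "?rhs \<longlonglongrightarrow> (g ((norm (x - y))\<^sup>2) + L * T + 0) / g (\<epsilon>\<^sup>2 / 4)"
      using g_pos by (intro tendsto_intros lim_const_over_n) auto
    have "(\<lambda>N. prob (?S - SN N) + (\<theta> + (prob (OS N) + (1 / (real N + 1) + ?rhs N))))
        \<longlonglongrightarrow> 0 + (\<theta> + (0 + (0 + (g ((norm (x - y))\<^sup>2) + L * T + 0) / g (\<epsilon>\<^sup>2 / 4))))"
      by (intro tendsto_add tendsto_const l1 l2 l3 l4)
    then have "prob ?S \<le> 0 + (\<theta> + (0 + (0 + (g ((norm (x - y))\<^sup>2) + L * T + 0) / g (\<epsilon>\<^sup>2 / 4))))"
      by (rule LIMSEQ_le_const) (use bound in \<open>auto intro!: exI[of _ 1]\<close>)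
    then show "prob ?S \<le> (g ((norm (x - y))\<^sup>2) + L * T) / g (\<epsilon>\<^sup>2 / 4) + \<theta>" by simp
  qed
qed

end

section \<open>Continuity in probability with respect to the initial point\<close>

theorem theorem3p4:
  fixes M :: "'a measure" and F :: "real \<Rightarrow> 'a measure"
    and W :: "real \<Rightarrow> 'a \<Rightarrow> real^'m"
    and \<sigma> :: "real^'d \<Rightarrow> real^'m^'d" and b :: "real^'d \<Rightarrow> real^'d"
    and r1 r1' r2 r2' :: "real \<Rightarrow> real" and C :: real
    and X :: "real^'d \<Rightarrow> real \<Rightarrow> 'a \<Rightarrow> real^'d"
  assumes cont_sigma: "continuous_on UNIV \<sigma>"
    and cont_b: "continuous_on UNIV b"
    and C_pos: "C > 0"
    \<comment> \<open>(a)\<close>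
    and r1_pos: "\<forall>s\<ge>1. r1 s > 0"
    and r1_deriv: "\<forall>s\<ge>1. (r1 has_real_derivative r1' s) (at s within {1..})"
    and r1'_cont: "continuous_on {1..} r1'"
    and r1_lim: "filterlim r1 at_top at_top"
    and r1_int: "(\<integral>\<^sup>+ s. ennreal (indicator {1..} s / (s * r1 s + 1)) \<partial>lborel) = \<infinity>"
    and r1_ratio: "((\<lambda>s. s * r1' s / r1 s) \<longlongrightarrow> 0) at_top"
    and growth_sigma: "\<forall>x. norm x \<ge> 1 \<longrightarrow>
        (norm (\<sigma> x))\<^sup>2 \<le> C * ((norm x)\<^sup>2 * r1 ((norm x)\<^sup>2) + 1)"
    and growth_b: "\<forall>x. norm x \<ge> 1 \<longrightarrow>
        norm (b x) \<le> C * (norm x * r1 ((norm x)\<^sup>2) + 1)"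
    \<comment> \<open>(b)\<close>
    and r2_pos: "\<forall>\<xi>. 0 < \<xi> \<and> \<xi> < 1 \<longrightarrow> r2 \<xi> > 0"
    and r2_deriv: "\<forall>\<xi>. 0 < \<xi> \<and> \<xi> < 1 \<longrightarrow> (r2 has_real_derivative r2' \<xi>) (at \<xi>)"
    and r2'_cont: "continuous_on {0<..<1} r2'"
    and r2_lim: "filterlim r2 at_top (at_right 0)"
    and r2_ratio: "((\<lambda>\<xi>. \<xi> * r2' \<xi> / r2 \<xi>) \<longlongrightarrow> 0) (at_right 0)"
    and r2_int: "\<forall>a. 0 < a \<and> a < 1 \<longrightarrow>
        (\<integral>\<^sup>+ s. ennreal (indicator {0<..a} s / (s * r2 s)) \<partial>lborel) = \<infinity>"
    and mod_sigma: "\<forall>x y. 0 < dist x y \<and> dist x y < 1 \<longrightarrow>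
        (norm (\<sigma> x - \<sigma> y))\<^sup>2 \<le> C * (dist x y)\<^sup>2 * r2 ((dist x y)\<^sup>2)"
    and mod_b: "\<forall>x y. 0 < dist x y \<and> dist x y < 1 \<longrightarrow>
        norm (b x - b y) \<le> C * dist x y * r2 ((dist x y)\<^sup>2)"
    \<comment> \<open>Brownian motion and the solutions\<close>
    and BM: "brownian_motion M F W"
    and sol: "\<forall>x0. sde_solution M F W \<sigma> b x0 (X x0)"
  shows "\<forall>x0 t \<epsilon>. t > 0 \<longrightarrow> \<epsilon> > 0 \<longrightarrow>
     ((\<lambda>y0. measure M {\<omega> \<in> space M.
         (SUP s\<in>{0..t}. norm (X y0 s \<omega> - X x0 s \<omega>)) > \<epsilon>}) \<longlongrightarrow> 0) (at x0)"
proof (intro allI impI)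
  fix x0 :: "real^'d" and t \<epsilon> :: real assume t: "0 < t" and \<epsilon>: "0 < \<epsilon>"
  interpret prob_space M using BM by (simp add: brownian_motion_def)
  obtain a \<mu> where a: "0 < a" "a < 1"
    and \<mu>: "continuous_on UNIV \<mu>" "mono \<mu>" "\<And>s. 0 \<le> \<mu> s" and \<mu>0: "\<mu> 0 = 0"
    and \<mu>_eq: "\<And>s. 0 < s \<Longrightarrow> s \<le> a \<Longrightarrow> \<mu> s = s * r2 s"
    using osgood_modulus[OF r2_pos r2_deriv r2_ratio r2_int] by blast
  have mod_\<sigma>: "(norm (\<sigma> u - \<sigma> v))\<^sup>2 \<le> C * \<mu> ((dist u v)\<^sup>2)"
    and mod_b': "dist u v * norm (b u - b v) \<le> C * \<mu> ((dist u v)\<^sup>2)" if "(dist u v)\<^sup>2 \<le> a" for u v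
  proof -
    have "dist u v < 1" using that a by (simp add: power2_less_imp_less[of _ 1])
    then have "(norm (\<sigma> u - \<sigma> v))\<^sup>2 \<le> C * \<mu> ((dist u v)\<^sup>2) \<and>
      dist u v * norm (b u - b v) \<le> C * \<mu> ((dist u v)\<^sup>2)"
    proof (cases "u = v")
      case True
      then show ?thesis using \<mu>(3)[of 0] C_pos by simp
    next
      case False
      then have d: "0 < dist u v" by simp
      then have eq: "\<mu> ((dist u v)\<^sup>2) = (dist u v)\<^sup>2 * r2 ((dist u v)\<^sup>2)"
        using that by (intro \<mu>_eq) auto
      \<comment> \<open>Multiplying the bound on \<open>b\<close> by the distance produces the same
        modulus \<open>\<mu>\<close> as for \<open>\<sigma>\<close>.\<close>
      have "dist u v * norm (b u - b v) \<le> dist u v * (C * dist u v * r2 ((dist u v)\<^sup>2))"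
        using mod_b d \<open>dist u v < 1\<close> by (intro mult_left_mono) auto
      then show ?thesis
        using mod_sigma[rule_format, of u v] d \<open>dist u v < 1\<close>
        unfolding eq by (simp add: power2_eq_square mult_ac)
    qed
    then show "(norm (\<sigma> u - \<sigma> v))\<^sup>2 \<le> C * \<mu> ((dist u v)\<^sup>2)"
      "dist u v * norm (b u - b v) \<le> C * \<mu> ((dist u v)\<^sup>2)" by auto
  qed
  \<comment> \<open>A smaller threshold only enlarges the exceedance event; this one ensures
    \<open>4 * e\<^sup>2 \<le> a\<close>.\<close>
  define e where "e = min \<epsilon> (sqrt a / 2)"
  have e: "0 < e" "e \<le> \<epsilon>" using \<epsilon> a by (auto simp: e_def)
  have "e\<^sup>2 \<le> (sqrt a / 2)\<^sup>2" using e by (intro power_mono) (auto simp: e_def)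
  then have e4: "4 * e\<^sup>2 \<le> a" using a by (simp add: power_divide)
  define L where "L = 4 * C + 2 * real CARD('m) * C"
  let ?P = "\<lambda>y0. prob {\<omega> \<in> space M. (SUP s\<in>{0..t}. norm (X y0 s \<omega> - X x0 s \<omega>)) > \<epsilon>}"
  have bound: "?P y0 \<le> ((norm (y0 - x0))\<^sup>2 / \<delta> + L * t) / osgood_lyapunov \<mu> \<delta> (e\<^sup>2 / 4)"
    if \<delta>: "0 < \<delta>" and G: "0 < osgood_lyapunov \<mu> \<delta> (e\<^sup>2 / 4)" for y0 \<delta>
  proof -
    interpret sde_pair M F W \<sigma> b y0 x0 "X y0" "X x0" C a t \<mu>
      using BM sol cont_sigma cont_b C_pos t \<mu> mod_\<sigma> mod_b' by unfold_locales auto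
    \<comment> \<open>Continuity makes the supremum that of a bounded set, so a value above
      \<open>\<epsilon>\<close> is witnessed at a time. Only the larger event has to be measurable
      for the comparison of probabilities.\<close>
    have "{\<omega> \<in> space M. (SUP s\<in>{0..t}. norm (X y0 s \<omega> - X x0 s \<omega>)) > \<epsilon>}
        \<subseteq> {\<omega> \<in> space M. \<exists>s\<in>{0..t}. e < norm (gap s \<omega>)}"
    proof safe
      fix \<omega> assume \<omega>: "\<omega> \<in> space M" "\<epsilon> < (SUP s\<in>{0..t}. norm (X y0 s \<omega> - X x0 s \<omega>))"
      have "compact ((\<lambda>s. norm (X y0 s \<omega> - X x0 s \<omega>)) ` {0..t})"
        using path_continuous[OF \<omega>(1)] by (intro compact_continuous_image continuous_intros) auto
      then have "bdd_above ((\<lambda>s. norm (X y0 s \<omega> - X x0 s \<omega>)) ` {0..t})"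
        by (intro bounded_imp_bdd_above compact_imp_bounded)
      then have "\<exists>s\<in>{0..t}. \<epsilon> < norm (X y0 s \<omega> - X x0 s \<omega>)"
        using \<omega>(2) t by (subst (asm) less_cSUP_iff) auto
      then show "\<exists>s\<in>{0..t}. e < norm (gap s \<omega>)"
        using e(2) by (auto simp: gap_def intro: le_less_trans)
    qed
    then have "?P y0 \<le> prob {\<omega> \<in> space M. \<exists>s\<in>{0..t}. e < norm (gap s \<omega>)}"
      by (intro finite_measure_mono gap_sup_bound(1)[OF e(1) e4 \<delta> G])
    also have "\<dots> \<le> (osgood_lyapunov \<mu> \<delta> ((norm (y0 - x0))\<^sup>2) + L * t) / osgood_lyapunov \<mu> \<delta> (e\<^sup>2 / 4)"
      unfolding L_def by (rule gap_sup_bound(2)[OF e(1) e4 \<delta> G])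
    also have "\<dots> \<le> ((norm (y0 - x0))\<^sup>2 / \<delta> + L * t) / osgood_lyapunov \<mu> \<delta> (e\<^sup>2 / 4)"
    proof (intro divide_right_mono add_right_mono)
      \<comment> \<open>The tangent at 0 has slope \<open>1 / \<delta>\<close>, which makes this
        term vanish as \<open>y0\<close> tends to \<open>x0\<close> with \<open>\<delta>\<close>
        fixed.\<close>
      have "osgood_lyapunov \<mu> \<delta> ((norm (y0 - x0))\<^sup>2) \<le> 1 / (\<mu> 0 + \<delta>) * (norm (y0 - x0))\<^sup>2"
        using osgood_lyapunov_concave[OF \<mu> \<delta>, of 0 "(norm (y0 - x0))\<^sup>2"]
        by (simp add: osgood_lyapunov_def)
      then show "osgood_lyapunov \<mu> \<delta> ((norm (y0 - x0))\<^sup>2) \<le> (norm (y0 - x0))\<^sup>2 / \<delta>"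
        using \<mu>0 by simp
    qed (use G in simp)
    finally show ?thesis .
  qed
  show "(?P \<longlongrightarrow> 0) (at x0)"
  proof (rule tendstoI)
    fix \<theta> :: real assume \<theta>: "0 < \<theta>"
    have c: "0 < e\<^sup>2 / 4" "e\<^sup>2 / 4 \<le> a" "e\<^sup>2 / 4 < 1" using e e4 a by auto
    have "(\<integral>\<^sup>+ s. ennreal (indicator {0<..e\<^sup>2 / 4} s / \<mu> s) \<partial>lborel)
        = (\<integral>\<^sup>+ s. ennreal (indicator {0<..e\<^sup>2 / 4} s / (s * r2 s)) \<partial>lborel)"
      using \<mu>_eq c by (intro nn_integral_cong) (auto simp: indicator_def)
    then have inf: "(\<integral>\<^sup>+ s. ennreal (indicator {0<..e\<^sup>2 / 4} s / \<mu> s) \<partial>lborel) = \<infinity>"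
      using r2_int c by simp
    have pos: "0 < \<mu> s" if "0 < s" "s \<le> e\<^sup>2 / 4" for s
      using \<mu>_eq[of s] r2_pos that c by simp
    \<comment> \<open>\<open>\<delta>\<close> is fixed before \<open>y0\<close>: it brings
      \<open>L * t / ?G\<close> below \<open>\<theta>\<close>, and the maximum with 0 keeps
      \<open>?G\<close> positive.\<close>
    obtain \<delta> where \<delta>: "0 < \<delta>" "max 0 (L * t / \<theta>) < osgood_lyapunov \<mu> \<delta> (e\<^sup>2 / 4)" (is "_ < ?G")
      using osgood_lyapunov_unbounded[OF \<mu> c(1) inf pos] by blast
    have G: "0 < ?G" using \<delta>(2) by simp
    have "L * t / ?G < \<theta>" using \<delta>(2) \<theta> G by (simp add: field_simps)
    moreover have "((\<lambda>y0. ((norm (y0 - x0))\<^sup>2 / \<delta> + L * t) / ?G)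
        \<longlongrightarrow> ((norm (x0 - x0))\<^sup>2 / \<delta> + L * t) / ?G) (at x0)"
      using \<delta>(1) G by (intro tendsto_intros) auto
    ultimately have "\<forall>\<^sub>F y0 in at x0. ((norm (y0 - x0))\<^sup>2 / \<delta> + L * t) / ?G < \<theta>"
      by (intro order_tendstoD(2)) auto
    then show "\<forall>\<^sub>F y0 in at x0. dist (?P y0) 0 < \<theta>"
    proof eventually_elim
      case (elim y0)
      then show ?case using bound[OF \<delta>(1) G, of y0] by simp
    qed
  qed
qed

end
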